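(* Let $K^*\in\{1,\dots,M\}$ be the (data-dependent) number of coefficients selected by maximizing either $\mathrm{BIC}(K)$ or $\mathrm{AIC}(K)$, and let $D_{(K^* )}=n\sum_{(k)=1}^{K^*}\widehat{\theta}^2_{(k)}$ be the deviance statistic of the selected estimator. As $n\to\infty$, a valid post-selection bound for the p-value to test $H_0$: $d(\bm{u})=1$ for all $\bm{u}\in[0,1]^p$, versus $H_1$: there exists $\bm{u}\in[0,1]^p$ with $d(\bm{u})\neq1$, is $$\text{p-value}_{adj}=P(\chi^2_M>D_{\mathrm{obs}}),$$ where $D_{\mathrm{obs}}$ is the observed value of $D_{(K^* )}$. That is, under $H_0$, for every $t\ge0$, $$\limsup_{n\to\infty}P\bigl(D_{(K^* )}>t\bigr)\le P(\chi^2_M>t).$$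
   Context: Setting. $\bm{X}=(X_1,\dots,X_p)$ is a random vector with values in $\mathcal{X}\subseteq\mathbb{R}^p$, with true distribution function $F$; $G$ is a hypothesized distribution function. Both are continuous with densities $f$ and $g$ (with respect to Lebesgue measure), and $f(\bm{x})=0$ whenever $g(\bm{x})=0$. The density $g$ factorizes as $g(\bm{x})=\prod_{d=1}^p g_d(x_d|\bm{x}_{<d})$ with $\bm{x}_{<d}=(x_1,\dots,x_{d-1})$, where $g_d(\cdot|\bm{x}_{<d})$ are (conditional) densities with cdfs $G_d(\cdot|\bm{x}_{<d})$ and quantile functions $G_d^{-1}(\cdot|\bm{x}_{<d})$. The Rosenblatt transformation is $\bm{G}_R(\bm{x})=(G_1(x_1),G_2(x_2|x_1),\dots,G_p(x_p|\bm{x}_{<p}))\in[0,1]^p$, with inverse $\bm{G}_R^{-1}(\bm{u})=(x_1,\dots,x_p)$ defined recursively by $x_d=G_d^{-1}(u_d|\bm{x}_{<d})$. The likelihood ratio is $d(\bm{u})=f(\bm{G}_R^{-1}(\bm{u}))/g(\bm{G}_R^{-1}(\bm{u}))$, $\bm{u}\in[0,1]^p$, and it is assumed that $d\in L^2[0,1]^p$; $H_0$ is equivalent to $F\equiv G$. Basis. $T_j$, $j\ge 0$, is the $j$-th normalized shifted Legendre polynomial on $[0,1]$ ($T_0=1$, $T_1(u)=\sqrt{12}(u-0.5)$, and so on; $\{T_j\}_{j\ge0}$ is orthonormal in $L^2[0,1]$), and for a $p$-tuple $k=(j_1,\dots,j_p)$ of nonnegative integers, $T_k(\bm{u})=\prod_{d=1}^p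 T_{j_d}(u_d)$. Truncation and estimation. Fix (before seeing the data) nonnegative integers $m_1,\dots,m_p$, not all zero, and let $\mathcal{K}$ be the set of all $p$-tuples $(j_1,\dots,j_p)\neq(0,\dots,0)$ with $0\le j_d\le m_d$ for all $d$; its cardinality is $M=\prod_{d=1}^p(m_d+1)-1$. Given i.i.d. observations $\bm{x}_1,\dots,\bm{x}_n$ from $\bm{X}$, let $\widehat{\theta}_k=\frac1n\sum_{i=1}^nT_k(\bm{G}_R(\bm{x}_i))$, $k\in\mathcal{K}$. Model selection. Order the estimates by magnitude, $\widehat{\theta}_{(1)}^2\ge\widehat{\theta}_{(2)}^2\ge\dots\ge\widehat{\theta}_{(M)}^2$, and let $T_{(k)}$ be the basis function corresponding to $\widehat{\theta}_{(k)}$. The criteria are $\mathrm{BIC}(K)=\sum_{(k)=1}^K\widehat{\theta}_{(k)}^2-\frac{K\log n}{n}$ and $\mathrm{AIC}(K)=\sum_{(k)=1}^K\widehat{\theta}_{(k)}^2-\frac{2K}{n}$, $K=1,\dots,M$. One of the two is chosen and $K^*$ is its maximizer; the selected estimator of $d$ is $\widehat{d}_{(K^* )}(\bm{u})=1+\sum_{(k)=1}^{K^*}\widehat{\theta}_{(k)}T_{(k)}(\bm{u})$. *)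

theory Defs
  imports "HOL-Probability.Probability" "HOL-Computational_Algebra.Polynomial"
begin

text \<open>
  Points of \<open>\<real>\<^sup>p\<close> are extensional functions on \<open>{..<p}\<close>, so coordinates are numbered
  \<open>0, \<dots>, p - 1\<close> and the prefix \<open>x\<^bsub><d\<^esub>\<close> of a point \<open>x\<close>, consisting of the coordinates before the
  one with number \<open>d\<close>, is \<open>restrict x {..<d}\<close>.
\<close>

definition lborel_pow :: "nat \<Rightarrow> (nat \<Rightarrow> real) measure" where
  "lborel_pow p = (\<Pi>\<^sub>M d\<in>{..<p}. lborel)"

definition unit_cube :: "nat \<Rightarrow> (nat \<Rightarrow> real) set" where
  "unit_cube p = (\<Pi>\<^sub>E d\<in>{..<p}. {0..1})"

definition is_pdf :: "'b measure \<Rightarrow> ('b \<Rightarrow> real) \<Rightarrow> bool" where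
  "is_pdf N h \<longleftrightarrow> h \<in> borel_measurable N \<and> (\<forall>x\<in>space N. 0 \<le> h x) \<and> (\<integral>\<^sup>+x. ennreal (h x) \<partial>N) = 1"


section \<open>Conditional densities and the Rosenblatt transformation\<close>

text \<open>In the following, \<open>gc d y t\<close> stands for the conditional density \<open>g\<^sub>d(t | x\<^bsub><d\<^esub> = y)\<close>.\<close>

type_synonym cond_densities = "nat \<Rightarrow> (nat \<Rightarrow> real) \<Rightarrow> real \<Rightarrow> real"

definition prefix_density :: "cond_densities \<Rightarrow> nat \<Rightarrow> (nat \<Rightarrow> real) \<Rightarrow> real" where
  "prefix_density gc d x = (\<Prod>e<d. gc e (restrict x {..<e}) (x e))"

text \<open>
  Conditional densities matter only where the conditioning prefix has positive density;
  at the other prefixes \<open>gc\<close> is unconstrained apart from measurability.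
\<close>

definition is_cond_densities :: "nat \<Rightarrow> cond_densities \<Rightarrow> bool" where
  "is_cond_densities p gc \<longleftrightarrow>
     (\<forall>d<p. (\<lambda>(y, t). gc d y t) \<in> borel_measurable (lborel_pow d \<Otimes>\<^sub>M lborel) \<and>
            (\<forall>y\<in>space (lborel_pow d). prefix_density gc d y > 0 \<longrightarrow> is_pdf lborel (gc d y)))"

definition cond_cdf :: "cond_densities \<Rightarrow> nat \<Rightarrow> (nat \<Rightarrow> real) \<Rightarrow> real \<Rightarrow> real" where
  "cond_cdf gc d y t = (LINT s:{..t}|lborel. gc d y s)"

text \<open>
  For \<open>0 < u < 1\<close> this is the usual generalized inverse. At \<open>u = 0\<close> and \<open>u = 1\<close> the quantile
  may be infinite, and the real-valued \<open>Inf\<close> below is then an arbitrary number; this concerns only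
  the boundary of the unit cube, a null set.
\<close>

definition cond_quantile :: "cond_densities \<Rightarrow> nat \<Rightarrow> (nat \<Rightarrow> real) \<Rightarrow> real \<Rightarrow> real" where
  "cond_quantile gc d y u = Inf {t. u \<le> cond_cdf gc d y t}"

definition rosenblatt :: "nat \<Rightarrow> cond_densities \<Rightarrow> (nat \<Rightarrow> real) \<Rightarrow> nat \<Rightarrow> real" where
  "rosenblatt p gc x = (\<lambda>d\<in>{..<p}. cond_cdf gc d (restrict x {..<d}) (x d))"

primrec inv_rosenblatt :: "nat \<Rightarrow> cond_densities \<Rightarrow> (nat \<Rightarrow> real) \<Rightarrow> nat \<Rightarrow> real" where
  "inv_rosenblatt 0 gc u = (\<lambda>_. undefined)"
| "inv_rosenblatt (Suc d) gc u =
     (let y = inv_rosenblatt d gc u in y(d := cond_quantile gc d y (u d)))"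

definition likelihood_ratio ::
  "nat \<Rightarrow> ((nat \<Rightarrow> real) \<Rightarrow> real) \<Rightarrow> ((nat \<Rightarrow> real) \<Rightarrow> real) \<Rightarrow> cond_densities \<Rightarrow> (nat \<Rightarrow> real) \<Rightarrow> real"
where
  "likelihood_ratio p f g gc u = f (inv_rosenblatt p gc u) / g (inv_rosenblatt p gc u)"

text \<open>Membership in \<open>L\<^sup>2[0,1]\<^sup>p\<close>, with respect to (complete) Lebesgue measure.\<close>

definition in_L2_cube :: "nat \<Rightarrow> ((nat \<Rightarrow> real) \<Rightarrow> real) \<Rightarrow> bool" where
  "in_L2_cube p h \<longleftrightarrow>
     set_borel_measurable (completion (lborel_pow p)) (unit_cube p) h \<and>
     set_integrable (completion (lborel_pow p)) (unit_cube p) (\<lambda>u. (h u)\<^sup>2)"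

text \<open>
  The null hypothesis \<open>d(u) = 1\<close> on \<open>[0,1]\<^sup>p\<close>. As \<open>d\<close> is an element of \<open>L\<^sup>2[0,1]\<^sup>p\<close>, built from
  densities and quantiles that are determined only almost everywhere (on a null set of \<open>u\<close> the
  quotient may be \<open>0/0\<close> or a quantile infinite), the equality is required for almost every
  \<open>u\<close>. This is weaker than, and hence as a hypothesis covers, equality at every \<open>u\<close>.
\<close>

definition null_hypothesis ::
  "nat \<Rightarrow> ((nat \<Rightarrow> real) \<Rightarrow> real) \<Rightarrow> ((nat \<Rightarrow> real) \<Rightarrow> real) \<Rightarrow> cond_densities \<Rightarrow> bool" where
  "null_hypothesis p f g gc \<longleftrightarrow>
     (AE u in lborel_pow p. u \<in> unit_cube p \<longrightarrow> likelihood_ratio p f g gc u = 1)"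


section \<open>The Legendre basis and the estimated coefficients\<close>

text \<open>Rodrigues' formula \<open>T\<^sub>j(u) = \<surd>(2j+1) / j! \<cdot> (d/du)\<^sup>j (u\<^sup>2 - u)\<^sup>j\<close>.\<close>

definition legendre :: "nat \<Rightarrow> real \<Rightarrow> real" where
  "legendre j u = sqrt (2 * real j + 1) / fact j * poly ((pderiv ^^ j) ([:0, -1, 1:] ^ j)) u"

lemma legendre_0: "legendre 0 u = 1"
  by (simp add: legendre_def)

lemma legendre_1: "legendre 1 u = sqrt 12 * (u - 1 / 2)"
proof -
  have "sqrt (12::real) = 2 * sqrt 3"
    using real_sqrt_mult[of 4 3] by simp
  then show ?thesis
    by (simp add: legendre_def pderiv_pCons algebra_simps)
qed

definition tensor_legendre :: "nat \<Rightarrow> (nat \<Rightarrow> nat) \<Rightarrow> (nat \<Rightarrow> real) \<Rightarrow> real" where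
  "tensor_legendre p k u = (\<Prod>d<p. legendre (k d) (u d))"

definition index_set :: "nat \<Rightarrow> (nat \<Rightarrow> nat) \<Rightarrow> (nat \<Rightarrow> nat) set" where
  "index_set p m = (\<Pi>\<^sub>E d\<in>{..<p}. {..m d}) - {\<lambda>d\<in>{..<p}. 0}"

definition num_coeffs :: "nat \<Rightarrow> (nat \<Rightarrow> nat) \<Rightarrow> nat" where
  "num_coeffs p m = card (index_set p m)"

lemma num_coeffs_eq: "num_coeffs p m = (\<Prod>d<p. m d + 1) - 1"
proof -
  have "(\<lambda>d\<in>{..<p}. 0) \<in> (\<Pi>\<^sub>E d\<in>{..<p}. {..m d})"
    by auto
  then show ?thesis
    by (simp add: num_coeffs_def index_set_def card_PiE card_Diff_singleton)
qed

text \<open>\<open>X i\<close>, \<open>i < n\<close>, are the \<open>n\<close> observations.\<close>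

definition theta_hat ::
  "nat \<Rightarrow> cond_densities \<Rightarrow> (nat \<Rightarrow> nat \<Rightarrow> real) \<Rightarrow> nat \<Rightarrow> (nat \<Rightarrow> nat) \<Rightarrow> real" where
  "theta_hat p gc X n k = (\<Sum>i<n. tensor_legendre p k (rosenblatt p gc (X i))) / real n"


section \<open>Model selection and deviance\<close>

text \<open>
  Here \<open>\<theta>\<close> is a family of estimates indexed by tuples, and \<open>s\<close> enumerates the tuples by
  decreasing magnitude, so that \<open>\<theta> (s i)\<close> is \<open>\<theta>\<^bsub>(i)\<^esub>\<close>. Ties may be broken in any way.
\<close>

definition magnitude_order ::
  "nat \<Rightarrow> (nat \<Rightarrow> nat) \<Rightarrow> ((nat \<Rightarrow> nat) \<Rightarrow> real) \<Rightarrow> (nat \<Rightarrow> nat \<Rightarrow> nat) \<Rightarrow> bool" where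
  "magnitude_order p m \<theta> s \<longleftrightarrow>
     bij_betw s {1..num_coeffs p m} (index_set p m) \<and>
     (\<forall>i\<in>{1..num_coeffs p m}. \<forall>j\<in>{1..num_coeffs p m}. i \<le> j \<longrightarrow> (\<theta> (s j))\<^sup>2 \<le> (\<theta> (s i))\<^sup>2)"

type_synonym selection_criterion =
  "nat \<Rightarrow> ((nat \<Rightarrow> nat) \<Rightarrow> real) \<Rightarrow> (nat \<Rightarrow> nat \<Rightarrow> nat) \<Rightarrow> nat \<Rightarrow> real"

definition BIC :: selection_criterion where
  "BIC n \<theta> s K = (\<Sum>i=1..K. (\<theta> (s i))\<^sup>2) - real K * ln (real n) / real n"

definition AIC :: selection_criterion where
  "AIC n \<theta> s K = (\<Sum>i=1..K. (\<theta> (s i))\<^sup>2) - 2 * real K / real n"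

definition deviance :: "nat \<Rightarrow> ((nat \<Rightarrow> nat) \<Rightarrow> real) \<Rightarrow> (nat \<Rightarrow> nat \<Rightarrow> nat) \<Rightarrow> nat \<Rightarrow> real" where
  "deviance n \<theta> s K = real n * (\<Sum>i=1..K. (\<theta> (s i))\<^sup>2)"

text \<open>The law of the sum of the squares of \<open>r\<close> independent standard normal variables.\<close>

definition chi_square :: "nat \<Rightarrow> real measure" where
  "chi_square r = distr (\<Pi>\<^sub>M i\<in>{..<r}. density lborel std_normal_density) borel (\<lambda>z. \<Sum>i<r. (z i)\<^sup>2)"

definition adjusted_p_value :: "nat \<Rightarrow> (nat \<Rightarrow> nat) \<Rightarrow> real \<Rightarrow> real" where
  "adjusted_p_value p m D_obs = measure (chi_square (num_coeffs p m)) {y. y > D_obs}"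

end

theory Submission
  imports Defs
begin

text \<open>
  Whatever \<open>K\<close> is selected, the deviance is at most \<open>S = n \<Sum>\<^sub>k \<theta>\<^sub>k\<^sup>2\<close>, the sum over all \<open>M\<close> coefficients, so it is
  enough that \<open>S\<close> converges in distribution to \<open>\<chi>\<^sup>2\<close> with \<open>M\<close> degrees of freedom. Under the null
  hypothesis the Rosenblatt transforms of the observations are independent and uniform on the cube,
  hence \<open>S\<close> is the squared norm of a normalized sum \<open>Z\<close> of independent vectors with mean \<open>0\<close> and
  identity covariance.

  The multivariate limit is reduced to the one-dimensional central limit theorem by writing
  \<open>exp (- c\<^sup>2 \<bar>z\<bar>\<^sup>2 / 2)\<close> as the mean of \<open>exp (\<i> c \<langle>v, z\<rangle>)\<close> over a standard Gaussian \<open>v\<close>: this gives the limits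
  of all moments of \<open>exp (- S) \<in> [0, 1]\<close>, and these determine weak convergence by Weierstrass
  approximation.
\<close>

section \<open>A central limit theorem for squared norms\<close>

text \<open>A continuous test function is within \<open>e / 3\<close> of a polynomial on
  \<open>{0..1}\<close>, and the integral of a polynomial is a finite combination of moments; the
  usual three-term estimate does the rest.\<close>

lemma weak_conv_of_moments:
  fixes \<mu> :: "nat \<Rightarrow> real measure"
  assumes \<mu>: "\<And>n. real_distribution (\<mu> n)" and \<nu>: "real_distribution \<nu>"
    and \<mu>_supp: "\<And>n. AE x in \<mu> n. x \<in> {0..1}" and \<nu>_supp: "AE x in \<nu>. x \<in> {0..1}"
    and moments: "\<And>k. (\<lambda>n. \<integral>x. x ^ k \<partial>\<mu> n) \<longlonglongrightarrow> (\<integral>x. x ^ k \<partial>\<nu>)"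
  shows "weak_conv_m \<mu> \<nu>"
proof (rule integral_bdd_continuous_conv_imp_weak_conv[OF \<mu> \<nu>])
  fix f :: "real \<Rightarrow> real"
  assume f_cont: "\<And>x. isCont f x" and f_bdd: "\<And>x. \<bar>f x\<bar> \<le> 1"
  have [measurable]: "f \<in> borel_measurable borel"
    using f_cont by (intro borel_measurable_continuous_onI continuous_at_imp_continuous_on) auto
  show "(\<lambda>n. integral\<^sup>L (\<mu> n) f) \<longlonglongrightarrow> integral\<^sup>L \<nu> f"
  proof (rule LIMSEQ_I)
    fix e :: real assume "0 < e"
    then have e3: "0 < e / 3" by simp
    have "continuous_on {0..1} f"
      using f_cont by (intro continuous_at_imp_continuous_on) auto
    then obtain q where q: "real_polynomial_function q" "\<And>x. x \<in> {0..1} \<Longrightarrow> \<bar>f x - q x\<bar> < e / 3"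
      using Stone_Weierstrass_real_polynomial_function[of "{0..1}" f "e / 3"] e3 by auto
    then obtain a N where q_eq: "q = (\<lambda>x. \<Sum>i\<le>N. a i * x ^ i)"
      using real_polynomial_function_iff_sum by blast
    have mom_int: "integrable \<rho> (\<lambda>x. x ^ k)"
      if "real_distribution \<rho>" "AE x in \<rho>. x \<in> {0..1}" for \<rho> :: "real measure" and k
    proof -
      interpret real_distribution \<rho> by fact
      show ?thesis
        using that(2) by (intro integrable_const_bound[of _ 1])
          (auto simp del: atLeastAtMost_iff elim!: eventually_mono, simp add: power_le_one)
    qed
    have q_int: "integrable \<rho> q" "integral\<^sup>L \<rho> q = (\<Sum>i\<le>N. a i * (\<integral>x. x ^ i \<partial>\<rho>))"
      if "real_distribution \<rho>" "AE x in \<rho>. x \<in> {0..1}" for \<rho>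
      unfolding q_eq using mom_int[OF that] by (auto simp: Bochner_Integration.integral_sum)
    \<comment> \<open>The approximation holds only on \<open>{0..1}\<close>, so the support
      assumption is what makes the two integrals close.\<close>
    have close: "\<bar>integral\<^sup>L \<rho> f - integral\<^sup>L \<rho> q\<bar> \<le> e / 3"
      if "real_distribution \<rho>" "AE x in \<rho>. x \<in> {0..1}" for \<rho>
    proof -
      interpret real_distribution \<rho> by fact
      have f_int: "integrable \<rho> f"
        using f_bdd by (intro integrable_const_bound[of _ 1]) auto
      have "\<bar>integral\<^sup>L \<rho> f - integral\<^sup>L \<rho> q\<bar> = \<bar>\<integral>x. f x - q x \<partial>\<rho>\<bar>"
        using f_int q_int[OF that] by simp
      also have "\<dots> \<le> (\<integral>x. \<bar>f x - q x\<bar> \<partial>\<rho>)" by (rule integral_abs_bound)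
      also have "\<dots> \<le> (\<integral>x. e / 3 \<partial>\<rho>)"
        using f_int q_int[OF that] that(2) q(2)
        by (intro integral_mono_AE)
          (auto simp del: atLeastAtMost_iff elim!: eventually_mono intro!: less_imp_le)
      also have "\<dots> = e / 3" using prob_space by simp
      finally show ?thesis .
    qed
    have "(\<lambda>n. integral\<^sup>L (\<mu> n) q) \<longlonglongrightarrow> integral\<^sup>L \<nu> q"
      unfolding q_int[OF \<mu> \<mu>_supp] q_int[OF \<nu> \<nu>_supp]
      by (intro tendsto_sum tendsto_mult tendsto_const moments)
    then obtain n0 where n0: "\<And>n. n \<ge> n0 \<Longrightarrow> \<bar>integral\<^sup>L (\<mu> n) q - integral\<^sup>L \<nu> q\<bar> < e / 3"
      using LIMSEQ_D[OF _ e3] by fastforce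
    have "norm (integral\<^sup>L (\<mu> n) f - integral\<^sup>L \<nu> f) < e" if "n \<ge> n0" for n
      using n0[OF that] close[OF \<mu> \<mu>_supp, of n] close[OF \<nu> \<nu>_supp] unfolding real_norm_def by argo
    then show "\<exists>n0. \<forall>n\<ge>n0. norm (integral\<^sup>L (\<mu> n) f - integral\<^sup>L \<nu> f) < e" by blast
  qed
qed

section \<open>Gaussian averages of characters\<close>

definition std_gaussian :: "nat \<Rightarrow> (nat \<Rightarrow> real) measure" where
  "std_gaussian r = (\<Pi>\<^sub>M i\<in>{..<r}. std_normal_distribution)"

lemma prob_space_std_gaussian: "prob_space (std_gaussian r)"
  unfolding std_gaussian_def
  using real_dist_normal_dist by (intro prob_space_PiM) (simp add: real_distribution_def)

lemma sets_std_gaussian [measurable_cong]: "sets (std_gaussian r) = sets (\<Pi>\<^sub>M i\<in>{..<r}. borel)"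
  unfolding std_gaussian_def by (intro sets_PiM_cong) auto

text \<open>By independence of the coordinates the integral is a product of one-dimensional
  characteristic functions. Read from right to left, it represents a Gaussian function of
  \<open>z\<close> as a mixture of characters, linear in \<open>z\<close> inside the
  exponent.\<close>

lemma char_std_gaussian:
  "(CLINT v|std_gaussian r. iexp (c * (\<Sum>j<r. v j * z j)))
     = complex_of_real (exp (- (c\<^sup>2 / 2) * (\<Sum>j<r. (z j)\<^sup>2)))"
proof -
  interpret N: real_distribution std_normal_distribution by (rule real_dist_normal_dist)
  interpret product_prob_space "\<lambda>_. std_normal_distribution" "{..<r}" by unfold_locales
  have "(CLINT v|std_gaussian r. iexp (c * (\<Sum>j<r. v j * z j)))
      = (CLINT v|(\<Pi>\<^sub>M i\<in>{..<r}. std_normal_distribution). (\<Prod>j<r. iexp ((c * z j) * v j)))"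
    unfolding std_gaussian_def
    by (intro Bochner_Integration.integral_cong)
       (simp_all add: exp_sum[symmetric] sum_distrib_left mult_ac)
  also have "\<dots> = (\<Prod>j<r. char std_normal_distribution (c * z j))"
    unfolding char_def
    by (intro product_integral_prod) (auto intro!: N.integrable_iexp)
  also have "\<dots> = complex_of_real (exp (- (c\<^sup>2 / 2) * (\<Sum>j<r. (z j)\<^sup>2)))"
    unfolding char_std_normal_distribution
    by (simp add: exp_sum[symmetric] sum_distrib_left power_mult_distrib flip: of_real_prod exp_of_real)
  finally show ?thesis .
qed

section \<open>Standardized independent vectors and their normalized sums\<close>

locale standardized_iid = prob_space M for M :: "'a measure" +
  fixes r :: nat and V :: "nat \<Rightarrow> 'a \<Rightarrow> nat \<Rightarrow> real" and D :: "(nat \<Rightarrow> real) measure"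
  assumes indep: "indep_vars (\<lambda>_. \<Pi>\<^sub>M j\<in>{..<r}. borel) V UNIV"
    and ident: "\<And>i. distr M (\<Pi>\<^sub>M j\<in>{..<r}. borel) (V i) = D"
    and sq_int: "\<And>i j. j < r \<Longrightarrow> integrable M (\<lambda>\<omega>. (V i \<omega> j)\<^sup>2)"
    and mean: "\<And>i j. j < r \<Longrightarrow> expectation (\<lambda>\<omega>. V i \<omega> j) = 0"
    and cov: "\<And>i j k. j < r \<Longrightarrow> k < r \<Longrightarrow>
                expectation (\<lambda>\<omega>. V i \<omega> j * V i \<omega> k) = (if j = k then 1 else 0)"
begin

lemma V_measurable: "V i \<in> measurable M (\<Pi>\<^sub>M j\<in>{..<r}. borel)"
  using indep by (auto simp: indep_vars_def)

lemma V_component_measurable: "j < r \<Longrightarrow> (\<lambda>\<omega>. V i \<omega> j) \<in> borel_measurable M"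
  using measurable_compose[OF V_measurable measurable_component_singleton, of j] by simp

definition Z :: "nat \<Rightarrow> 'a \<Rightarrow> nat \<Rightarrow> real" where
  "Z n \<omega> j = (\<Sum>i<n. V i \<omega> j) / sqrt (real n)"

lemma Z_component_measurable: "j < r \<Longrightarrow> (\<lambda>\<omega>. Z n \<omega> j) \<in> borel_measurable M"
  unfolding Z_def by (intro borel_measurable_divide borel_measurable_sum V_component_measurable) auto

text \<open>Projecting on a fixed \<open>v\<close> gives independent real variables with mean 0 and
  variance \<bar>v\<bar>^2, to which the one-dimensional central limit theorem and Levy continuity
  apply.\<close>

lemma char_Z_tendsto:
  shows "(\<lambda>n. CLINT \<omega>|M. iexp (c * (\<Sum>j<r. v j * Z n \<omega> j)))
           \<longlonglongrightarrow> complex_of_real (exp (- (c\<^sup>2 / 2) * (\<Sum>j<r. (v j)\<^sup>2)))"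
\<comment> \<open>For \<open>v = 0\<close> the projection has variance 0, which the central limit
  theorem excludes; both sides are then 1.\<close>
proof (cases "\<forall>j<r. v j = 0")
  case True
  then show ?thesis by (simp add: prob_space)
next
  case False
  define \<sigma> where "\<sigma> = sqrt (\<Sum>j<r. (v j)\<^sup>2)"
  have \<sigma>2: "\<sigma>\<^sup>2 = (\<Sum>j<r. (v j)\<^sup>2)"
    unfolding \<sigma>_def by (simp add: sum_nonneg)
  obtain j0 where "j0 < r" "v j0 \<noteq> 0"
    using False by blast
  then have "0 < (\<Sum>j<r. (v j)\<^sup>2)"
    by (intro sum_pos2[of _ j0]) auto
  then have \<sigma>_pos: "\<sigma> > 0" by (simp add: \<sigma>_def)
  note V_measurable [measurable]
  define g where "g y = (\<Sum>j<r. v j * y j)" for y :: "nat \<Rightarrow> real"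
  have g_meas [measurable]: "g \<in> borel_measurable (\<Pi>\<^sub>M j\<in>{..<r}. borel)"
    unfolding g_def by measurable
  have prod_int: "integrable M (\<lambda>\<omega>. V i \<omega> j * V i \<omega> k)" if "j < r" "k < r" for i j k
  proof (rule Bochner_Integration.integrable_bound)
    show "integrable M (\<lambda>\<omega>. (V i \<omega> j)\<^sup>2 + (V i \<omega> k)\<^sup>2)"
      using sq_int that by simp
    have "\<bar>V i \<omega> j * V i \<omega> k\<bar> \<le> (V i \<omega> j)\<^sup>2 + (V i \<omega> k)\<^sup>2" for \<omega>
      using sum_squares_bound[of "\<bar>V i \<omega> j\<bar>" "\<bar>V i \<omega> k\<bar>"] abs_ge_zero[of "V i \<omega> j * V i \<omega> k"]
      unfolding abs_mult power2_abs by linarith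
    then show "AE \<omega> in M. norm (V i \<omega> j * V i \<omega> k) \<le> norm ((V i \<omega> j)\<^sup>2 + (V i \<omega> k)\<^sup>2)"
      by simp
  qed (intro borel_measurable_times V_component_measurable that)
  have V_int: "integrable M (\<lambda>\<omega>. V i \<omega> j)" if "j < r" for i j
    by (rule square_integrable_imp_integrable[OF V_component_measurable[OF that] sq_int[OF that]])
  have gV_sq: "(g (V i \<omega>))\<^sup>2 = (\<Sum>j<r. \<Sum>k<r. v j * v k * (V i \<omega> j * V i \<omega> k))" for i \<omega>
    unfolding g_def power2_eq_square sum_product by (simp add: mult_ac)
  have g_mean: "expectation (\<lambda>\<omega>. g (V i \<omega>)) = 0" for i
    unfolding g_def using V_int mean by (subst Bochner_Integration.integral_sum) auto
  have clt: "weak_conv_m (\<lambda>n. distr M borel (\<lambda>\<omega>. (\<Sum>i<n. g (V i \<omega>)) / sqrt (n * \<sigma>\<^sup>2))) std_normal_distribution"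
  proof (rule central_limit_theorem_zero_mean[where \<mu> = "distr D borel g"])
    show "indep_vars (\<lambda>i. borel) (\<lambda>i \<omega>. g (V i \<omega>)) UNIV"
      by (rule indep_vars_compose2[OF indep]) simp
    show "integrable M (\<lambda>\<omega>. (g (V i \<omega>))\<^sup>2)" for i
      unfolding gV_sq
      by (intro Bochner_Integration.integrable_sum integrable_mult_right prod_int) auto
    show "variance (\<lambda>\<omega>. g (V i \<omega>)) = \<sigma>\<^sup>2" for i
    proof -
      have "variance (\<lambda>\<omega>. g (V i \<omega>)) = expectation (\<lambda>\<omega>. (g (V i \<omega>))\<^sup>2)"
        by (simp add: g_mean)
      also have "\<dots> = (\<Sum>j<r. \<Sum>k<r. v j * v k * expectation (\<lambda>\<omega>. V i \<omega> j * V i \<omega> k))"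
      proof -
        have "expectation (\<lambda>\<omega>. (g (V i \<omega>))\<^sup>2)
            = (\<Sum>j<r. expectation (\<lambda>\<omega>. \<Sum>k<r. v j * v k * (V i \<omega> j * V i \<omega> k)))"
          unfolding gV_sq
          by (intro Bochner_Integration.integral_sum Bochner_Integration.integrable_sum
                integrable_mult_right prod_int) auto
        also have "\<dots> = (\<Sum>j<r. \<Sum>k<r. expectation (\<lambda>\<omega>. v j * v k * (V i \<omega> j * V i \<omega> k)))"
          by (intro sum.cong refl Bochner_Integration.integral_sum integrable_mult_right prod_int) auto
        finally show ?thesis by simp
      qed
      also have "\<dots> = (\<Sum>j<r. \<Sum>k<r. if j = k then v j * v k else 0)"
        using cov by (intro sum.cong) auto
      also have "\<dots> = \<sigma>\<^sup>2" unfolding \<sigma>2 by (simp add: power2_eq_square)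
      finally show ?thesis .
    qed
    \<comment> \<open>The common law of the projections is the image of \<open>D\<close>: this is
      how the locale parameter supplies the single law that the central limit theorem asks
      for.\<close>
    show "distr M borel (\<lambda>\<omega>. g (V i \<omega>)) = distr D borel g" for i
      unfolding ident[of i, symmetric] by (subst distr_distr) (auto simp: comp_def)
  qed (use \<sigma>_pos g_mean in auto)
  \<comment> \<open>The limit theorem divides by an extra factor \<open>\<sigma>\<close>; evaluating
    the characteristic function at \<open>c * \<sigma>\<close> instead of \<open>c\<close> cancels
    it.\<close>
  have "(\<lambda>n. char (distr M borel (\<lambda>\<omega>. (\<Sum>i<n. g (V i \<omega>)) / sqrt (n * \<sigma>\<^sup>2))) (c * \<sigma>))
           \<longlonglongrightarrow> char std_normal_distribution (c * \<sigma>)"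
    using clt real_dist_normal_dist by (intro levy_continuity1) auto
  moreover have "char (distr M borel (\<lambda>\<omega>. (\<Sum>i<n. g (V i \<omega>)) / sqrt (n * \<sigma>\<^sup>2))) (c * \<sigma>)
      = (CLINT \<omega>|M. iexp (c * (\<Sum>j<r. v j * Z n \<omega> j)))" for n
  proof -
    have "(c * \<sigma>) * ((\<Sum>i<n. g (V i \<omega>)) / sqrt (n * \<sigma>\<^sup>2))
        = c * (\<Sum>j<r. v j * Z n \<omega> j)" for \<omega>
    proof -
      have "(\<Sum>j<r. v j * Z n \<omega> j) = (\<Sum>i<n. g (V i \<omega>)) / sqrt (real n)"
        unfolding g_def Z_def by (subst sum.swap) (simp add: sum_divide_distrib sum_distrib_left)
      then show ?thesis using \<sigma>_pos by (simp add: real_sqrt_mult)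
    qed
    then show ?thesis
      unfolding char_def by (subst integral_distr) auto
  qed
  moreover have "char std_normal_distribution (c * \<sigma>)
      = complex_of_real (exp (- (c\<^sup>2 / 2) * (\<Sum>j<r. (v j)\<^sup>2)))"
    by (simp add: char_std_normal_distribution power_mult_distrib \<sigma>2)
  ultimately show ?thesis by simp
qed


definition S :: "nat \<Rightarrow> 'a \<Rightarrow> real" where
  "S n \<omega> = (\<Sum>j<r. (Z n \<omega> j)\<^sup>2)"

lemma S_measurable [measurable]: "S n \<in> borel_measurable M"
  unfolding S_def[abs_def] by (intro borel_measurable_sum borel_measurable_power Z_component_measurable) auto

lemma S_nonneg: "0 \<le> S n \<omega>"
  unfolding S_def by (intro sum_nonneg) auto

text \<open>
  A Gaussian function is an average of characters, so its expectation under the law of \<open>Z n\<close> is an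
  average of values of the characteristic function.
\<close>

lemma laplace_S_tendsto:
  "(\<lambda>n. \<integral>\<omega>. exp (- (c\<^sup>2 / 2) * S n \<omega>) \<partial>M)
     \<longlonglongrightarrow> (\<integral>v. exp (- (c\<^sup>2 / 2) * (\<Sum>j<r. (v j)\<^sup>2)) \<partial>std_gaussian r)"
proof -
  interpret G: prob_space "std_gaussian r" by (rule prob_space_std_gaussian)
  interpret MG: pair_sigma_finite M "std_gaussian r" by unfold_locales
  interpret MGp: pair_prob_space M "std_gaussian r" by unfold_locales
  let ?h = "\<lambda>n \<omega> v. iexp (c * (\<Sum>j<r. v j * Z n \<omega> j))"
  have v_meas: "(\<lambda>v. v j) \<in> borel_measurable (std_gaussian r)" if "j < r" for j
    using that by simp
  have pair_meas: "case_prod (?h n) \<in> borel_measurable (M \<Otimes>\<^sub>M std_gaussian r)" for n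
  proof -
    have "(\<lambda>x. \<Sum>j<r. snd x j * Z n (fst x) j) \<in> borel_measurable (M \<Otimes>\<^sub>M std_gaussian r)"
      by (intro borel_measurable_sum borel_measurable_times
            measurable_compose[OF measurable_snd v_meas]
            measurable_compose[OF measurable_fst Z_component_measurable]) auto
    then show ?thesis
      unfolding split_beta' by measurable
  qed
  have h_int: "integrable (M \<Otimes>\<^sub>M std_gaussian r) (case_prod (?h n))" for n
    by (intro MGp.integrable_const_bound[of _ 1] pair_meas) (auto simp flip: of_real_mult)
  have swap: "complex_of_real (\<integral>\<omega>. exp (- (c\<^sup>2 / 2) * S n \<omega>) \<partial>M)
      = (CLINT v|std_gaussian r. CLINT \<omega>|M. ?h n \<omega> v)" for n
  proof -
    have "complex_of_real (\<integral>\<omega>. exp (- (c\<^sup>2 / 2) * S n \<omega>) \<partial>M)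
        = (CLINT \<omega>|M. CLINT v|std_gaussian r. ?h n \<omega> v)"
      unfolding char_std_gaussian S_def by simp
    also have "\<dots> = (CLINT v|std_gaussian r. CLINT \<omega>|M. ?h n \<omega> v)"
      by (rule MG.Fubini_integral[OF h_int, symmetric])
    finally show ?thesis .
  qed
  have "(\<lambda>n. CLINT v|std_gaussian r. CLINT \<omega>|M. ?h n \<omega> v)
      \<longlonglongrightarrow> (CLINT v|std_gaussian r. complex_of_real (exp (- (c\<^sup>2 / 2) * (\<Sum>j<r. (v j)\<^sup>2))))"
  proof (rule integral_dominated_convergence[where w = "\<lambda>_. 1"])
    show "(\<lambda>v. CLINT \<omega>|M. ?h n \<omega> v) \<in> borel_measurable (std_gaussian r)" for n
      using MG.integrable_snd[OF h_int] by (simp add: borel_measurable_integrable)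
    show "AE v in std_gaussian r. norm (CLINT \<omega>|M. ?h n \<omega> v) \<le> 1" for n
    proof (intro AE_I2)
      fix v
      have "norm (CLINT \<omega>|M. ?h n \<omega> v) \<le> (\<integral>\<omega>. norm (?h n \<omega> v) \<partial>M)"
        by (rule integral_norm_bound)
      also have "\<dots> = 1"
        by (simp add: prob_space flip: of_real_mult)
      finally show "norm (CLINT \<omega>|M. ?h n \<omega> v) \<le> 1" .
    qed
    show "AE v in std_gaussian r. (\<lambda>n. CLINT \<omega>|M. ?h n \<omega> v)
        \<longlonglongrightarrow> complex_of_real (exp (- (c\<^sup>2 / 2) * (\<Sum>j<r. (v j)\<^sup>2)))"
      using char_Z_tendsto by simp
  qed auto
  then show ?thesis
    unfolding swap[symmetric] integral_complex_of_real tendsto_of_real_iff .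
qed

text \<open>Passing from \<open>S\<close> to \<open>exp (- S)\<close> brings the values into the
  unit interval, and turns the Laplace transform at integer arguments into moments.\<close>

lemma exp_S_weak_conv:
  "weak_conv_m (\<lambda>n. distr M borel (\<lambda>\<omega>. exp (- S n \<omega>)))
     (distr (std_gaussian r) borel (\<lambda>v. exp (- (\<Sum>j<r. (v j)\<^sup>2))))"
proof (rule weak_conv_of_moments)
  interpret G: prob_space "std_gaussian r" by (rule prob_space_std_gaussian)
  show "real_distribution (distr M borel (\<lambda>\<omega>. exp (- S n \<omega>)))" for n
    by (intro real_distribution_distr) simp
  show "real_distribution (distr (std_gaussian r) borel (\<lambda>v. exp (- (\<Sum>j<r. (v j)\<^sup>2))))"
    by (intro G.real_distribution_distr) simp
  show "AE x in distr M borel (\<lambda>\<omega>. exp (- S n \<omega>)). x \<in> {0..1}" for n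
    using S_nonneg by (subst AE_distr_iff) auto
  show "AE x in distr (std_gaussian r) borel (\<lambda>v. exp (- (\<Sum>j<r. (v j)\<^sup>2))). x \<in> {0..1}"
    by (subst AE_distr_iff) (auto intro!: AE_I2 sum_nonneg)
  show "(\<lambda>n. \<integral>x. x ^ k \<partial>distr M borel (\<lambda>\<omega>. exp (- S n \<omega>)))
      \<longlonglongrightarrow> (\<integral>x. x ^ k \<partial>distr (std_gaussian r) borel (\<lambda>v. exp (- (\<Sum>j<r. (v j)\<^sup>2))))" for k
    \<comment> \<open>This choice makes \<open>c\<^sup>2 / 2 = k\<close>, so the integrand is the
      \<open>k\<close>-th power of \<open>exp (- S n \<omega>)\<close>.\<close>
    using laplace_S_tendsto[of "sqrt (2 * real k)"]
    by (simp add: integral_distr exp_of_nat_mult[symmetric])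
qed

end

text \<open>With all coordinates but the last fixed, at most two values of the last one satisfy the
  equation, and the normal law has no atoms. For \<open>r = 0\<close> and \<open>t = 0\<close> the
  set would be the whole space.\<close>

lemma std_gaussian_sphere_null:
  assumes "0 < r"
  shows "emeasure (std_gaussian r) {v \<in> space (std_gaussian r). (\<Sum>j<r. (v j)\<^sup>2) = t} = 0"
proof -
  obtain q where r: "r = Suc q" using assms gr0_implies_Suc by blast
  interpret N: real_distribution std_normal_distribution by (rule real_dist_normal_dist)
  interpret product_prob_space "\<lambda>_. std_normal_distribution" "{..<r}" by unfold_locales
  have pt: "emeasure std_normal_distribution A = 0" if "finite A" for A
  proof -
    have "A \<in> null_sets lborel" using that by (rule finite_imp_null_set_lborel)
    then show ?thesis
      by (simp add: emeasure_density null_sets_def nn_integral_null_set)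
  qed
  have fin: "finite {y::real. y\<^sup>2 = a}" for a
  proof (rule finite_subset)
    show "{y. y\<^sup>2 = a} \<subseteq> {sqrt a, - sqrt a}" by (auto simp: real_sqrt_abs)
  qed simp
  let ?E = "{v \<in> space (std_gaussian r). (\<Sum>j<r. (v j)\<^sup>2) = t}"
  have E [measurable]: "?E \<in> sets (std_gaussian r)" by measurable
  have "emeasure (std_gaussian r) ?E = (\<integral>\<^sup>+v. indicator ?E v \<partial>std_gaussian r)"
    by simp
  also have "\<dots> = (\<integral>\<^sup>+x. \<integral>\<^sup>+y. indicator ?E (x(q := y)) \<partial>std_normal_distribution
                        \<partial>\<Pi>\<^sub>M i\<in>{..<q}. std_normal_distribution)"
    using E unfolding std_gaussian_def r lessThan_Suc
    by (subst product_nn_integral_insert) auto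
  also have "\<dots> = 0"
  proof -
    have "(\<integral>\<^sup>+y. indicator ?E (x(q := y)) \<partial>std_normal_distribution) = 0" for x
    proof -
      have "(\<integral>\<^sup>+y. indicator ?E (x(q := y)) \<partial>std_normal_distribution)
          \<le> (\<integral>\<^sup>+y. indicator {y. y\<^sup>2 = t - (\<Sum>j<q. (x j)\<^sup>2)} y \<partial>std_normal_distribution)"
        by (intro nn_integral_mono) (auto simp: r split: split_indicator)
      also have "\<dots> = emeasure std_normal_distribution {y. y\<^sup>2 = t - (\<Sum>j<q. (x j)\<^sup>2)}"
        by (intro nn_integral_indicator) measurable
      also have "\<dots> = 0" by (rule pt[OF fin])
      finally show ?thesis by simp
    qed
    then show ?thesis by simp
  qed
  finally show ?thesis .
qed

context standardized_iid
begin

text \<open>Since \<open>exp (- x)\<close> decreases, \<open>S n \<omega> \<ge> t\<close> is the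
  event \<open>exp (- S n \<omega>) \<le> exp (- t)\<close>, whose probability is a value of a
  distribution function. The limit law has no atom there because spheres are null, and for the same
  reason \<open>\<ge>\<close> may become \<open>>\<close> in the limit.\<close>

lemma S_tail_tendsto:
  assumes "0 < r"
  shows "(\<lambda>n. measure M {\<omega> \<in> space M. S n \<omega> \<ge> t}) \<longlonglongrightarrow> measure (chi_square r) {y. y > t}"
proof -
  interpret G: prob_space "std_gaussian r" by (rule prob_space_std_gaussian)
  let ?N = "distr (std_gaussian r) borel (\<lambda>v. exp (- (\<Sum>j<r. (v j)\<^sup>2)))"
  let ?Q = "\<lambda>v::nat\<Rightarrow>real. \<Sum>j<r. (v j)\<^sup>2"
  interpret N: real_distribution ?N by (intro G.real_distribution_distr) simp
  have "measure ?N {exp (- t)} = measure (std_gaussian r) {v \<in> space (std_gaussian r). ?Q v = t}"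
    by (subst measure_distr) (auto intro!: arg_cong[where f = "measure _"])
  also have "\<dots> = 0"
    using std_gaussian_sphere_null[OF assms] by (simp add: measure_def)
  finally have "isCont (cdf ?N) (exp (- t))" by (simp add: N.isCont_cdf)
  then have "(\<lambda>n. cdf (distr M borel (\<lambda>\<omega>. exp (- S n \<omega>))) (exp (- t))) \<longlonglongrightarrow> cdf ?N (exp (- t))"
    using exp_S_weak_conv by (auto simp: weak_conv_m_def weak_conv_def)
  moreover have "cdf (distr M borel (\<lambda>\<omega>. exp (- S n \<omega>))) (exp (- t))
      = measure M {\<omega> \<in> space M. S n \<omega> \<ge> t}" for n
    unfolding cdf_def by (subst measure_distr) (auto intro!: arg_cong[where f = "measure _"])
  moreover have "cdf ?N (exp (- t)) = measure (chi_square r) {y. y > t}"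
  proof -
    have "cdf ?N (exp (- t)) = measure (std_gaussian r) {v \<in> space (std_gaussian r). ?Q v \<ge> t}"
      unfolding cdf_def by (subst measure_distr) (auto intro!: arg_cong[where f = "measure _"])
    also have "\<dots> = measure (std_gaussian r)
        ({v \<in> space (std_gaussian r). ?Q v > t} \<union> {v \<in> space (std_gaussian r). ?Q v = t})"
      by (rule arg_cong[where f = "measure _"]) auto
    also have "\<dots> = measure (std_gaussian r) {v \<in> space (std_gaussian r). ?Q v > t}"
      using std_gaussian_sphere_null[OF assms] by (intro measure_Un_null_set) auto
    also have "\<dots> = measure (chi_square r) {y. y > t}"
      unfolding chi_square_def std_gaussian_def[symmetric]
      by (subst measure_distr) (auto intro!: arg_cong[where f = "measure _"])
    finally show ?thesis .
  qed
  ultimately show ?thesis by simp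
qed

end

section \<open>Orthonormality of the Legendre polynomials\<close>

definition unit_integral :: "real poly \<Rightarrow> real" where
  "unit_integral q = (LINT x:{0..1}|lborel. poly q x)"

lemma set_integrable_poly: "set_integrable lborel {0..1} (poly q)" for q :: "real poly"
  by (intro borel_integrable_atLeastAtMost' continuous_intros)

lemma unit_integral_add: "unit_integral (p + q) = unit_integral p + unit_integral q"
  unfolding unit_integral_def poly_add
  by (rule set_integral_add(2)) (rule set_integrable_poly)+

lemma unit_integral_smult: "unit_integral (smult c q) = c * unit_integral q"
  unfolding unit_integral_def poly_smult by (rule set_integral_mult_right)

lemma unit_integral_0 [simp]: "unit_integral 0 = 0"
  unfolding unit_integral_def by (simp add: set_lebesgue_integral_def)

lemma unit_integral_pderiv: "unit_integral (pderiv q) = poly q 1 - poly q 0"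
proof -
  have "(LBINT x. indicator {0..1} x *\<^sub>R poly (pderiv q) x) = poly q 1 - poly q 0"
    by (rule integral_FTC_atLeastAtMost)
       (auto intro!: continuous_intros simp: has_real_derivative_iff_has_vector_derivative[symmetric]
             intro: has_field_derivative_at_within)
  then show ?thesis by (simp add: unit_integral_def set_lebesgue_integral_def)
qed

lemma unit_integral_by_parts:
  assumes "poly (a * b) 0 = 0" "poly (a * b) 1 = 0"
  shows "unit_integral (pderiv a * b) = - unit_integral (a * pderiv b)"
proof -
  have "unit_integral (a * pderiv b) + unit_integral (b * pderiv a) = 0"
    using unit_integral_pderiv[of "a * b"] unfolding pderiv_mult unit_integral_add assms by simp
  then show ?thesis by (simp add: mult.commute[of "pderiv a"])
qed

text \<open>Each differentiation lowers the multiplicity of the factor \<open>w\<close> by at most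
  one.\<close>

lemma higher_pderiv_power_dvd:
  fixes w :: "real poly"
  assumes "i \<le> j"
  shows "w ^ (j - i) dvd (pderiv ^^ i) (w ^ j)"
  using assms
proof (induction i)
  case (Suc i)
  then obtain n where n: "j - i = Suc n" "j - Suc i = n"
    by (metis Suc_diff_Suc Suc_le_lessD)
  from Suc obtain c where "(pderiv ^^ i) (w ^ j) = w ^ Suc n * c"
    unfolding n(1) by (metis Suc.IH Suc.prems Suc_leD n(1) dvdE)
  then have "(pderiv ^^ Suc i) (w ^ j)
      = w ^ n * (w * pderiv c + c * smult (of_nat (Suc n)) (pderiv w))"
    by (simp only: funpow.simps comp_apply pderiv_mult pderiv_power_Suc) (simp add: algebra_simps)
  then show ?case unfolding n by (metis dvd_triv_left)
qed simp

lemma higher_pderiv_power_root: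
  fixes w :: "real poly"
  assumes "i < j" "poly w x = 0"
  shows "poly ((pderiv ^^ i) (w ^ j)) x = 0"
proof -
  obtain c where "(pderiv ^^ i) (w ^ j) = w ^ (j - i) * c"
    using higher_pderiv_power_dvd[of i j w] assms(1) by (auto elim!: dvdE)
  then show ?thesis using assms by (simp add: poly_power)
qed

text \<open>Integrating by parts \<open>i\<close> times moves \<open>i\<close> derivatives from
  \<open>w ^ j\<close> to \<open>q\<close>. After each step fewer than \<open>j\<close> derivatives
  remain on \<open>w ^ j\<close>, which thus still vanishes at the roots 0 and 1 of
  \<open>w\<close>: there are no boundary terms.\<close>

lemma unit_integral_rodrigues:
  fixes w :: "real poly"
  assumes "poly w 0 = 0" "poly w 1 = 0" "i \<le> j"
  shows "unit_integral ((pderiv ^^ j) (w ^ j) * q)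
       = (- 1) ^ i * unit_integral ((pderiv ^^ (j - i)) (w ^ j) * (pderiv ^^ i) q)"
  using assms(3)
proof (induction i)
  case (Suc i)
  then obtain n where n: "j - i = Suc n" "j - Suc i = n" "n < j"
    by (metis Suc_diff_Suc Suc_le_lessD diff_less zero_less_Suc less_le_trans)
  have "unit_integral (pderiv ((pderiv ^^ n) (w ^ j)) * (pderiv ^^ i) q)
      = - unit_integral ((pderiv ^^ n) (w ^ j) * pderiv ((pderiv ^^ i) q))"
    using assms n(3) by (intro unit_integral_by_parts) (simp_all add: higher_pderiv_power_root)
  then show ?case using Suc n by simp
qed simp

text \<open>Euler's beta integral, by parts: each step lowers \<open>b\<close> by one and raises
  \<open>a\<close> by one. The second factor is \<open>x - 1\<close> rather than
  \<open>1 - x\<close>, to match \<open>x^2 - x = x (x - 1)\<close>, hence the sign.\<close>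

lemma unit_integral_beta:
  "unit_integral ([:0, 1:] ^ a * [:-1, 1:] ^ b) = (- 1) ^ b * fact a * fact b / fact (a + b + 1)"
proof (induction b arbitrary: a)
  case 0
  have "unit_integral (pderiv ([:0, 1:] ^ Suc a)) = 1"
    unfolding unit_integral_pderiv by (simp add: poly_power)
  then have "real (Suc a) * unit_integral ([:0, 1:] ^ a) = 1"
    by (simp add: pderiv_power_Suc pderiv_pCons unit_integral_smult del: power_Suc)
  then have "unit_integral ([:0, 1:] ^ a) = 1 / real (Suc a)"
    by (metis nonzero_eq_divide_eq mult.commute of_nat_neq_0)
  then show ?case by simp
next
  case (Suc b)
  have "unit_integral (pderiv ([:0, 1:] ^ Suc a) * [:-1, 1:] ^ Suc b)
      = - unit_integral ([:0, 1:] ^ Suc a * pderiv ([:-1, 1:] ^ Suc b))"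
    by (rule unit_integral_by_parts) simp_all
  then have "real (Suc a) * unit_integral ([:0, 1:] ^ a * [:-1, 1:] ^ Suc b)
      = - (real (Suc b) * unit_integral ([:0, 1:] ^ Suc a * [:-1, 1:] ^ b))"
    by (simp add: pderiv_power_Suc pderiv_pCons unit_integral_smult del: power_Suc of_nat_Suc)
  also have "\<dots> = real (Suc a) * ((- 1) ^ Suc b * fact a * fact (Suc b) / fact (a + Suc b + 1))"
    unfolding Suc.IH by (simp add: mult_ac)
  finally show ?case
    using of_nat_neq_0[of a, where 'a = real] unfolding mult_cancel_left by blast
qed

lemma higher_pderiv_degree:
  fixes p :: "real poly"
  assumes "degree p \<le> n"
  shows "(pderiv ^^ n) p = [:fact n * coeff p n:]"
proof (rule poly_eqI)
  fix i
  show "coeff ((pderiv ^^ n) p) i = coeff [:fact n * coeff p n:] i"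
    using assms by (cases i) (auto simp: coeff_higher_pderiv pochhammer_fact coeff_eq_0)
qed

text \<open>With all \<open>j\<close> derivatives shifted to the second factor, that factor is the
  derivative of order \<open>j + i\<close> of a polynomial of degree \<open>2 * i\<close>. It is 0
  for \<open>i < j\<close> and the constant \<open>fact (2 * j)\<close> for \<open>i = j\<close>,
  which leaves a beta integral.\<close>

lemma unit_integral_rodrigues_pair:
  fixes w :: "real poly"
  defines "w \<equiv> [:0, -1, 1:]"
  assumes "i \<le> j"
  shows "unit_integral ((pderiv ^^ j) (w ^ j) * (pderiv ^^ i) (w ^ i))
           = (if i = j then (fact j)\<^sup>2 / (2 * real j + 1) else 0)"
proof -
  have w_roots: "poly w 0 = 0" "poly w 1 = 0" by (simp_all add: w_def)
  have deg: "degree (w ^ k) = 2 * k" for k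
    unfolding w_def by (subst degree_power_eq) auto
  have swap: "unit_integral ((pderiv ^^ j) (w ^ j) * (pderiv ^^ i) (w ^ i))
      = (- 1) ^ j * unit_integral (w ^ j * (pderiv ^^ (j + i)) (w ^ i))"
    using unit_integral_rodrigues[OF w_roots order_refl, of j "(pderiv ^^ i) (w ^ i)"]
    by (simp add: funpow_add)
  show ?thesis
  proof (cases "i = j")
    case False
    then have "2 * i < j + i" using assms(2) by simp
    then have "(pderiv ^^ (j + i)) (w ^ i) = 0"
      by (subst higher_pderiv_degree) (auto simp: deg coeff_eq_0)
    then show ?thesis using False swap by simp
  next
    case True
    have "coeff (w ^ j) (2 * j) = 1"
      using lead_coeff_power[of w j] unfolding deg by (simp add: w_def)
    then have top: "(pderiv ^^ (j + j)) (w ^ j) = [:fact (2 * j):]"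
      by (subst higher_pderiv_degree) (auto simp: deg mult_2)
    have wj: "w ^ j = [:0, 1:] ^ j * [:-1, 1:] ^ j"
      unfolding power_mult_distrib[symmetric] by (simp add: w_def)
    have "unit_integral ((pderiv ^^ j) (w ^ j) * (pderiv ^^ i) (w ^ i))
        = (- 1) ^ j * unit_integral (w ^ j * [:fact (2 * j):])"
      using swap unfolding True top .
    also have "w ^ j * [:fact (2 * j):] = smult (fact (2 * j)) (w ^ j)"
      by simp
    also have "unit_integral \<dots> = fact (2 * j) * ((- 1) ^ j * fact j * fact j / fact (j + j + 1))"
      unfolding unit_integral_smult wj unit_integral_beta ..
    \<comment> \<open>One sign comes from the integrations by parts, the other from the beta
      integral; they cancel.\<close>
    also have "(- 1) ^ j * \<dots> = ((- 1) * (- 1)) ^ j * (fact (2 * j) * (fact j)\<^sup>2 / fact (Suc (2 * j)))"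
      unfolding power_mult_distrib by (simp add: power2_eq_square mult_2 del: fact_Suc)
    also have "\<dots> = (fact j)\<^sup>2 / (2 * real j + 1)"
      by (simp add: add.commute)
    finally show ?thesis using True by simp
  qed
qed

text \<open>The factor \<open>sqrt (2 * real j + 1) / fact j\<close> in \<open>legendre\<close> is
  the reciprocal of the norm found for the Rodrigues polynomial.\<close>

lemma legendre_orthonormal:
  "set_integrable lborel {0..1} (\<lambda>u. legendre i u * legendre j u)"
  "(LINT u:{0..1}|lborel. legendre i u * legendre j u) = (if i = j then 1 else 0)"
proof -
  let ?R = "\<lambda>j. (pderiv ^^ j) ([:0, -1, 1:] ^ j) :: real poly"
  let ?c = "\<lambda>j. sqrt (2 * real j + 1) / fact j"
  have eq: "legendre i u * legendre j u = poly (smult (?c i * ?c j) (?R i * ?R j)) u" for u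
    by (simp add: legendre_def)
  show "set_integrable lborel {0..1} (\<lambda>u. legendre i u * legendre j u)"
    unfolding eq by (rule set_integrable_poly)
  have "unit_integral (?R i * ?R j) = (if i = j then (fact j)\<^sup>2 / (2 * real j + 1) else 0)"
    using unit_integral_rodrigues_pair[of i j] unit_integral_rodrigues_pair[of j i]
    by (cases "i \<le> j") (auto simp: mult.commute)
  then have "(LINT u:{0..1}|lborel. legendre i u * legendre j u)
      = ?c i * ?c j * (if i = j then (fact j)\<^sup>2 / (2 * real j + 1) else 0)"
    unfolding eq unit_integral_def[symmetric] unit_integral_smult by simp
  also have "\<dots> = (if i = j then 1 else 0)"
    by (simp add: power2_eq_square)
  finally show "(LINT u:{0..1}|lborel. legendre i u * legendre j u) = (if i = j then 1 else 0)" .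
qed

section \<open>The Rosenblatt transformation\<close>

lemma real_distribution_pdf:
  assumes "is_pdf lborel h"
  shows "real_distribution (density lborel h)"
proof -
  have "h \<in> borel_measurable lborel" "(\<integral>\<^sup>+x. ennreal (h x) \<partial>lborel) = 1"
    using assms by (auto simp: is_pdf_def)
  then have "prob_space (density lborel h)"
    by (intro prob_spaceI) (simp add: emeasure_density)
  then show ?thesis
    by (simp add: real_distribution_def real_distribution_axioms_def)
qed

lemma cdf_pdf:
  assumes "is_pdf lborel h"
  shows "cdf (density lborel h) t = (LINT s:{..t}|lborel. h s)"
proof -
  have h [measurable]: "h \<in> borel_measurable lborel" and nn: "\<And>x. 0 \<le> h x"
    using assms by (auto simp: is_pdf_def)
  have "(LINT s:{..t}|lborel. h s) = enn2real (\<integral>\<^sup>+s. ennreal (indicator {..t} s *\<^sub>R h s) \<partial>lborel)"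
    unfolding set_lebesgue_integral_def using nn by (intro integral_eq_nn_integral) auto
  also have "(\<integral>\<^sup>+s. ennreal (indicator {..t} s *\<^sub>R h s) \<partial>lborel) = emeasure (density lborel h) {..t}"
    by (subst emeasure_density) (auto intro!: nn_integral_cong simp: indicator_def)
  finally show ?thesis by (simp add: cdf_def measure_def)
qed

lemma isCont_cdf_pdf:
  assumes "is_pdf lborel h"
  shows "isCont (cdf (density lborel h)) x"
proof -
  interpret real_distribution "density lborel h" by (rule real_distribution_pdf[OF assms])
  have [measurable]: "h \<in> borel_measurable lborel" using assms by (auto simp: is_pdf_def)
  have "emeasure (density lborel h) {x} = 0"
    by (subst emeasure_density) (auto intro!: nn_integral_null_set)
  then show ?thesis by (simp add: isCont_cdf measure_def)
qed

text \<open>For \<open>0 < u < 1\<close> the set where \<open>cdf \<mu>\<close> is at most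
  \<open>u\<close> is a half-line ending at a point where the value \<open>u\<close> is attained, so
  its mass is \<open>u\<close>. Levels outside this range follow from monotonicity and the bounds 0
  and 1.\<close>

lemma distr_cdf_uniform:
  assumes "real_distribution \<mu>" and cont: "\<And>x. isCont (cdf \<mu>) x"
  shows "distr \<mu> borel (cdf \<mu>) = uniform_measure lborel {0..1}"
proof (rule cdf_unique)
  interpret real_distribution \<mu> by fact
  have H [measurable]: "cdf \<mu> \<in> borel_measurable borel"
    using cont by (intro borel_measurable_continuous_onI continuous_at_imp_continuous_on) auto
  let ?\<rho> = "distr \<mu> borel (cdf \<mu>)" and ?U = "uniform_measure lborel {0..1::real}"
  show rho: "real_distribution ?\<rho>" by (rule real_distribution_distr[OF measurable_finite_borel[OF H]])
  interpret R: real_distribution ?\<rho> by (rule rho)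
  have "prob_space ?U" by (rule prob_space_uniform_measure) auto
  then show U: "real_distribution ?U"
    by (simp add: real_distribution_def real_distribution_axioms_def)
  have cdf_rho: "cdf ?\<rho> u = measure \<mu> {x. cdf \<mu> x \<le> u}" for u
    unfolding cdf_def[of ?\<rho>] by (subst measure_distr) (auto intro!: arg_cong[where f = "measure _"])
  have inner: "cdf ?\<rho> u = u" if u: "0 < u" "u < 1" for u
  proof -
    have "eventually (\<lambda>x. cdf \<mu> x < u) at_bot"
      using cdf_lim_at_bot u by (auto dest: order_tendstoD)
    then obtain a where a: "cdf \<mu> a < u" by (auto simp: eventually_at_bot_linorder)
    have "eventually (\<lambda>x. u < cdf \<mu> x) at_top"
      using cdf_lim_at_top_prob u by (auto dest: order_tendstoD)
    then obtain b where b: "u < cdf \<mu> b" by (auto simp: eventually_at_top_linorder)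
    have ab: "a \<le> b" using a b cdf_nondecreasing[of b a] by (meson le_cases less_imp_le not_less order_trans)
    obtain c where c: "cdf \<mu> c = u"
      using IVT[of "cdf \<mu>" a u b] a b ab cont by (auto simp: less_imp_le)
    \<comment> \<open>\<open>cdf \<mu>\<close> may be constant near \<open>c\<close>, so the
      half-line ends at \<open>Sup ?A\<close>, the last point at level \<open>u\<close>, rather than
      at \<open>c\<close> itself.\<close>
    let ?A = "{x. cdf \<mu> x \<le> u}"
    have bdd: "bdd_above ?A"
      using b cdf_nondecreasing by (intro bdd_aboveI[of _ b]) (smt (verit) mem_Collect_eq)
    have "closed ?A"
      using cont by (intro closed_Collect_le continuous_intros continuous_at_imp_continuous_on) auto
    then have Sup_A: "Sup ?A \<in> ?A"
      using bdd c by (intro closed_contains_Sup) auto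
    have "cdf \<mu> (Sup ?A) = u"
      using Sup_A c cdf_nondecreasing[of c "Sup ?A"] cSup_upper[of c ?A] bdd by auto
    moreover have "?A = {..Sup ?A}"
      using Sup_A bdd cdf_nondecreasing by (auto intro: cSup_upper order_trans)
    ultimately show ?thesis
      unfolding cdf_rho by (metis cdf_def)
  qed
  show "cdf ?\<rho> = cdf ?U"
  proof
    fix u :: real
    have U_eq: "cdf ?U u = (if u < 0 then 0 else if u < 1 then u else 1)"
      unfolding cdf_def by (auto simp: measure_uniform_measure Int_atLeastAtMostR1)
    consider "u < 0" | "u = 0" | "0 < u" "u < 1" | "1 \<le> u" by linarith
    then show "cdf ?\<rho> u = cdf ?U u"
    proof cases
      case 1
      then have "{x. cdf \<mu> x \<le> u} = {}" using cdf_nonneg by (auto simp: not_le intro: less_le_trans)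
      then show ?thesis using 1 unfolding cdf_rho U_eq by simp
    next
      case 2
      \<comment> \<open>The value 0 need not be attained by \<open>cdf \<mu>\<close>, so level 0 is
        squeezed from above by small positive levels; the minimum with \<open>1/2\<close> keeps
        these below 1, as \<open>inner\<close> requires.\<close>
      have "cdf ?\<rho> 0 \<le> 0"
      proof (rule field_le_epsilon)
        fix e :: real assume "0 < e"
        then show "cdf ?\<rho> 0 \<le> 0 + e"
          using R.cdf_nondecreasing[of 0 "min e (1/2)"] inner[of "min e (1/2)"] by auto
      qed
      then show ?thesis using 2 R.cdf_nonneg[of 0] unfolding U_eq by simp
    next
      case 3
      then show ?thesis unfolding U_eq inner[OF 3] by simp
    next
      case 4
      then have "{x. cdf \<mu> x \<le> u} = space \<mu>" using cdf_bounded_prob by (auto intro: order_trans)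
      then show ?thesis using 4 prob_space unfolding cdf_rho U_eq by simp
    qed
  qed
qed

text \<open>The substitution \<open>v = H(t)\<close>, with \<open>H\<close> the distribution
  function of \<open>h\<close>. It compares image measures and does not invert \<open>H\<close>, so
  \<open>h\<close> may vanish on intervals.\<close>

lemma nn_integral_probability_transform:
  fixes h :: "real \<Rightarrow> real"
  assumes pdf: "is_pdf lborel h" and \<phi> [measurable]: "\<phi> \<in> borel_measurable borel"
  shows "(\<integral>\<^sup>+t. ennreal (h t) * \<phi> (LINT s:{..t}|lborel. h s) \<partial>lborel)
       = (\<integral>\<^sup>+v. indicator {0..1} v * \<phi> v \<partial>lborel)"
proof -
  have h [measurable]: "h \<in> borel_measurable lborel" using pdf by (simp add: is_pdf_def)
  let ?\<mu> = "density lborel h"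
  interpret real_distribution ?\<mu> by (rule real_distribution_pdf[OF pdf])
  have [measurable]: "cdf ?\<mu> \<in> borel_measurable borel"
    using isCont_cdf_pdf[OF pdf]
    by (intro borel_measurable_continuous_onI continuous_at_imp_continuous_on) auto
  have "(\<integral>\<^sup>+t. ennreal (h t) * \<phi> (LINT s:{..t}|lborel. h s) \<partial>lborel) = (\<integral>\<^sup>+t. \<phi> (cdf ?\<mu> t) \<partial>?\<mu>)"
    unfolding cdf_pdf[OF pdf, symmetric] by (subst nn_integral_density) auto
  also have "\<dots> = (\<integral>\<^sup>+v. \<phi> v \<partial>uniform_measure lborel {0..1})"
    unfolding distr_cdf_uniform[OF real_distribution_pdf[OF pdf] isCont_cdf_pdf[OF pdf], symmetric]
    by (subst nn_integral_distr) auto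
  also have "\<dots> = (\<integral>\<^sup>+v. indicator {0..1} v * \<phi> v \<partial>lborel)"
    by (subst nn_integral_uniform_measure) (auto simp: mult.commute divide_ennreal_def)
  finally show ?thesis .
qed

text \<open>If some \<open>t < x\<close> had a value at least that at \<open>x\<close>, monotonicity
  would make the distribution function constant on \<open>[t, x]\<close>, and a rational in between
  would violate \<open>distinct\<close>. So \<open>x\<close> is the minimum of the set.\<close>

lemma quantile_cdf:
  fixes h :: "real \<Rightarrow> real"
  assumes pdf: "is_pdf lborel h"
    and distinct: "\<And>q::rat. (LINT s:{..x}|lborel. h s) \<noteq> (LINT s:{..of_rat q}|lborel. h s)"
  shows "Inf {t. (LINT s:{..x}|lborel. h s) \<le> (LINT s:{..t}|lborel. h s)} = x"
proof -
  interpret real_distribution "density lborel h" by (rule real_distribution_pdf[OF pdf])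
  let ?H = "cdf (density lborel h)"
  have "x \<le> t" if "?H x \<le> ?H t" for t
  proof (rule ccontr)
    assume "\<not> x \<le> t"
    then obtain q :: rat where "t < of_rat q" "of_rat q < x"
      using of_rat_dense[of t x] by auto
    then have "?H t \<le> ?H (of_rat q)" "?H (of_rat q) \<le> ?H x"
      by (auto intro: cdf_nondecreasing)
    then have "?H x = ?H (of_rat q)" using that by simp
    then show False using distinct[of q] by (simp add: cdf_pdf[OF pdf])
  qed
  then have "Inf {t. ?H x \<le> ?H t} = x" by (intro cInf_eq_minimum) auto
  then show ?thesis by (simp add: cdf_pdf[OF pdf])
qed

section \<open>Lebesgue measure on finite powers, one coordinate at a time\<close>

lemma space_lborel_pow: "space (lborel_pow d) = extensional {..<d}"
  by (simp add: lborel_pow_def space_PiM PiE_def)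

lemma sets_lborel_pow [measurable_cong]: "sets (lborel_pow d) = sets (\<Pi>\<^sub>M e\<in>{..<d}. borel)"
  unfolding lborel_pow_def by (intro sets_PiM_cong) auto

lemma measurable_fun_upd_lborel_pow:
  "(\<lambda>(y, t). y(d := t)) \<in> measurable (lborel_pow d \<Otimes>\<^sub>M lborel) (lborel_pow (Suc d))"
  unfolding lborel_pow_def lessThan_Suc by (rule measurable_add_dim)

lemma measurable_restrict_lborel_pow:
  "e \<le> d \<Longrightarrow> (\<lambda>x. restrict x {..<e}) \<in> measurable (lborel_pow d) (lborel_pow e)"
  unfolding lborel_pow_def by (rule measurable_restrict_subset) auto

lemma measurable_component_lborel_pow:
  "e < d \<Longrightarrow> (\<lambda>x. x e) \<in> borel_measurable (lborel_pow d)"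
  unfolding lborel_pow_def by simp

lemma nn_integral_lborel_pow_Suc:
  assumes "\<phi> \<in> borel_measurable (lborel_pow (Suc d))"
  shows "(\<integral>\<^sup>+x. \<phi> x \<partial>lborel_pow (Suc d)) = (\<integral>\<^sup>+y. \<integral>\<^sup>+t. \<phi> (y(d := t)) \<partial>lborel \<partial>lborel_pow d)"
proof -
  interpret product_sigma_finite "\<lambda>_. lborel :: real measure" by unfold_locales
  show ?thesis
    using assms unfolding lborel_pow_def lessThan_Suc by (intro product_nn_integral_insert) auto
qed

lemma restrict_fun_upd_below:
  fixes d e :: nat
  shows "e \<le> d \<Longrightarrow> restrict (y(d := t)) {..<e} = restrict y {..<e}"
  by (auto simp: fun_eq_iff)

lemma unit_cube_measurable [measurable]: "unit_cube d \<in> sets (lborel_pow d)"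
  unfolding unit_cube_def lborel_pow_def by (intro sets_PiM_I_finite) auto

section \<open>Prefix densities and the law of the transformed point\<close>

locale cond_density_family =
  fixes p :: nat and gc :: cond_densities
  assumes cond_densities: "is_cond_densities p gc"
begin

lemma gc_measurable: "d < p \<Longrightarrow> (\<lambda>(y, t). gc d y t) \<in> borel_measurable (lborel_pow d \<Otimes>\<^sub>M lborel)"
  using cond_densities by (auto simp: is_cond_densities_def)

lemma gc_pdf:
  "d < p \<Longrightarrow> y \<in> space (lborel_pow d) \<Longrightarrow> 0 < prefix_density gc d y \<Longrightarrow> is_pdf lborel (gc d y)"
  using cond_densities by (auto simp: is_cond_densities_def)

lemma prefix_density_Suc:
  "y \<in> space (lborel_pow d) \<Longrightarrow>
     prefix_density gc (Suc d) (y(d := t)) = prefix_density gc d y * gc d y t"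
  unfolding prefix_density_def space_lborel_pow
  by (simp add: restrict_fun_upd_below extensional_restrict)

lemma prefix_density_restrict:
  "d \<le> e \<Longrightarrow> prefix_density gc d (restrict x {..<e}) = prefix_density gc d x"
  unfolding prefix_density_def by (intro prod.cong) (auto simp: Int_absorb1)

text \<open>A conditional density is known to be nonnegative only at prefixes of positive density.
  At the other prefixes the product already contains a zero, so the sign of later factors does not
  matter.\<close>

lemma prefix_density_nonneg: "d \<le> p \<Longrightarrow> 0 \<le> prefix_density gc d x"
proof (induction d)
  case (Suc d)
  have step: "prefix_density gc (Suc d) x = prefix_density gc d x * gc d (restrict x {..<d}) (x d)"
    by (simp add: prefix_density_def)
  show ?case
  proof (cases "prefix_density gc d x = 0")
    case False
    then have "is_pdf lborel (gc d (restrict x {..<d}))"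
      using Suc by (intro gc_pdf) (auto simp: prefix_density_restrict space_lborel_pow)
    then show ?thesis using Suc unfolding step by (simp add: is_pdf_def)
  qed (simp add: step)
qed (simp add: prefix_density_def)

lemma prefix_density_pos:
  assumes "d \<le> e" "e \<le> p" "0 < prefix_density gc e x"
  shows "0 < prefix_density gc d x"
proof -
  have "prefix_density gc d x \<noteq> 0"
  proof
    assume "prefix_density gc d x = 0"
    then obtain a where "a < d" "gc a (restrict x {..<a}) (x a) = 0"
      by (auto simp: prefix_density_def)
    then have "prefix_density gc e x = 0"
      unfolding prefix_density_def using assms(1) by (intro prod_zero) auto
    then show False using assms(3) by simp
  qed
  then show ?thesis using prefix_density_nonneg[of d x] assms by simp
qed

lemma gc_component_measurable:
  assumes "e < d" "d \<le> p"
  shows "(\<lambda>x. gc e (restrict x {..<e}) (x e)) \<in> borel_measurable (lborel_pow d)"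
proof -
  have "(\<lambda>x. (restrict x {..<e}, x e)) \<in> measurable (lborel_pow d) (lborel_pow e \<Otimes>\<^sub>M lborel)"
    using assms by (intro measurable_Pair measurable_restrict_lborel_pow)
      (auto intro: measurable_component_lborel_pow)
  from measurable_compose[OF this gc_measurable] show ?thesis using assms by simp
qed

lemma prefix_density_measurable:
  "d \<le> p \<Longrightarrow> prefix_density gc d \<in> borel_measurable (lborel_pow d)"
  unfolding prefix_density_def[abs_def]
  by (intro borel_measurable_prod gc_component_measurable) auto

text \<open>The upper limit of integration enters through the indicator of \<open>s \<le> t\<close>,
  which is jointly measurable, so the claim is measurability of an integral depending on
  parameters.\<close>

lemma cond_cdf_measurable:
  assumes "d < p"
  shows "(\<lambda>(y, t). cond_cdf gc d y t) \<in> borel_measurable (lborel_pow d \<Otimes>\<^sub>M borel)"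
proof -
  note gc_measurable[OF assms, measurable]
  have "(\<lambda>(z, s). indicator {..snd z} s *\<^sub>R gc d (fst z) s)
      \<in> borel_measurable ((lborel_pow d \<Otimes>\<^sub>M borel) \<Otimes>\<^sub>M lborel)"
  proof -
    have "(\<lambda>w. gc d (fst (fst w)) (snd w)) \<in> borel_measurable ((lborel_pow d \<Otimes>\<^sub>M borel) \<Otimes>\<^sub>M lborel)"
      using measurable_compose[of "\<lambda>w. (fst (fst w), snd w)" _ _ "\<lambda>(y, t). gc d y t" borel]
        gc_measurable[OF assms] by simp
    moreover have "(\<lambda>w :: ((nat \<Rightarrow> real) \<times> real) \<times> real. indicator {..snd (fst w)} (snd w) :: real)
        \<in> borel_measurable ((lborel_pow d \<Otimes>\<^sub>M borel) \<Otimes>\<^sub>M lborel)"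
    proof -
      have "indicator {..snd (fst w)} (snd w) = (if snd w \<le> snd (fst w) then 1 else 0 :: real)"
        for w :: "((nat \<Rightarrow> real) \<times> real) \<times> real"
        by (auto simp: indicator_def)
      then show ?thesis by simp
    qed
    ultimately show ?thesis unfolding split_beta' by (intro borel_measurable_scaleR)
  qed
  from lborel.borel_measurable_lebesgue_integral[OF this]
  show ?thesis
    unfolding cond_cdf_def set_lebesgue_integral_def split_beta' .
qed

text \<open>The endpoint is an arbitrary measurable \<open>\<tau>\<close> because both the
  coordinate \<open>x e\<close> and fixed rational numbers are substituted for it.\<close>

lemma cond_cdf_component_measurable:
  assumes "e < d" "d \<le> p" "\<tau> \<in> borel_measurable (lborel_pow d)"
  shows "(\<lambda>x. cond_cdf gc e (restrict x {..<e}) (\<tau> x)) \<in> borel_measurable (lborel_pow d)"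
proof -
  have "(\<lambda>x. (restrict x {..<e}, \<tau> x)) \<in> measurable (lborel_pow d) (lborel_pow e \<Otimes>\<^sub>M borel)"
    using assms by (intro measurable_Pair measurable_restrict_lborel_pow) auto
  from measurable_compose[OF this cond_cdf_measurable] show ?thesis using assms by simp
qed

lemma rosenblatt_measurable:
  assumes "d \<le> p"
  shows "rosenblatt d gc \<in> measurable (lborel_pow d) (lborel_pow d)"
proof -
  have "(\<lambda>x. \<lambda>e\<in>{..<d}. cond_cdf gc e (restrict x {..<e}) (x e))
      \<in> measurable (lborel_pow d) (\<Pi>\<^sub>M e\<in>{..<d}. borel)"
    using assms
    by (intro measurable_restrict cond_cdf_component_measurable measurable_component_lborel_pow) auto
  then show ?thesis
    unfolding rosenblatt_def[abs_def] by (simp add: measurable_cong_sets[OF refl sets_lborel_pow])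
qed

lemma rosenblatt_Suc:
  "y \<in> space (lborel_pow d) \<Longrightarrow>
     rosenblatt (Suc d) gc (y(d := t)) = (rosenblatt d gc y)(d := cond_cdf gc d y t)"
  unfolding rosenblatt_def space_lborel_pow
  by (auto simp: fun_eq_iff restrict_fun_upd_below extensional_restrict less_Suc_eq)

text \<open>Integrate the last coordinate first; the density of the prefix does not involve it and
  comes out. This is the recursion behind both inductions on the dimension below.\<close>

lemma nn_integral_prefix_density_Suc:
  assumes d: "d < p" and \<phi>: "\<phi> \<in> borel_measurable (lborel_pow (Suc d))"
  shows "(\<integral>\<^sup>+x. ennreal (prefix_density gc (Suc d) x) * \<phi> x \<partial>lborel_pow (Suc d))
       = (\<integral>\<^sup>+y. ennreal (prefix_density gc d y) * (\<integral>\<^sup>+t. ennreal (gc d y t) * \<phi> (y(d := t)) \<partial>lborel)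
            \<partial>lborel_pow d)"
proof -
  have [measurable]: "prefix_density gc (Suc d) \<in> borel_measurable (lborel_pow (Suc d))"
    using d by (intro prefix_density_measurable) simp
  note \<phi> [measurable]
  have "(\<integral>\<^sup>+x. ennreal (prefix_density gc (Suc d) x) * \<phi> x \<partial>lborel_pow (Suc d))
      = (\<integral>\<^sup>+y. \<integral>\<^sup>+t. ennreal (prefix_density gc (Suc d) (y(d := t))) * \<phi> (y(d := t)) \<partial>lborel \<partial>lborel_pow d)"
    by (rule nn_integral_lborel_pow_Suc) measurable
  \<comment> \<open>\<open>ennreal\<close> of the product splits because its first factor is
    nonnegative; \<open>gc d y t\<close> can be negative only where that factor is 0.\<close>
  also have "\<dots> = (\<integral>\<^sup>+y. \<integral>\<^sup>+t. ennreal (prefix_density gc d y) * (ennreal (gc d y t) * \<phi> (y(d := t)))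
                      \<partial>lborel \<partial>lborel_pow d)"
    using prefix_density_nonneg[of d] d
    by (intro nn_integral_cong) (simp add: prefix_density_Suc ennreal_mult' mult.assoc)
  also have "\<dots> = (\<integral>\<^sup>+y. ennreal (prefix_density gc d y) *
                          (\<integral>\<^sup>+t. ennreal (gc d y t) * \<phi> (y(d := t)) \<partial>lborel) \<partial>lborel_pow d)"
  proof (intro nn_integral_cong nn_integral_cmult)
    fix y assume y: "y \<in> space (lborel_pow d)"
    have "(\<lambda>t. gc d y t) \<in> borel_measurable lborel"
      using measurable_compose[OF measurable_Pair1'[OF y] gc_measurable[OF d]] by simp
    moreover have "(\<lambda>t. \<phi> (y(d := t))) \<in> borel_measurable lborel"
      using measurable_compose[OF measurable_compose[OF measurable_Pair1'[OF y]
              measurable_fun_upd_lborel_pow] \<phi>] by simp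
    ultimately show "(\<lambda>t. ennreal (gc d y t) * \<phi> (y(d := t))) \<in> borel_measurable lborel"
      by measurable
  qed
  finally show ?thesis .
qed

text \<open>Given the prefix, the last transformed coordinate is uniform whatever the prefix is.
  Averaging it out leaves a function of the transformed prefix alone, to which the induction
  hypothesis, general in \<open>\<phi>\<close>, applies.\<close>

lemma nn_integral_rosenblatt:
  assumes "d \<le> p" "\<phi> \<in> borel_measurable (lborel_pow d)"
  shows "(\<integral>\<^sup>+x. ennreal (prefix_density gc d x) * \<phi> (rosenblatt d gc x) \<partial>lborel_pow d)
       = (\<integral>\<^sup>+u. indicator (unit_cube d) u * \<phi> u \<partial>lborel_pow d)"
  using assms
proof (induction d arbitrary: \<phi>)
  case 0
  have "space (lborel_pow 0) = {\<lambda>_. undefined}" by (simp add: space_lborel_pow)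
  then show ?case
    by (intro nn_integral_cong) (auto simp: prefix_density_def rosenblatt_def unit_cube_def fun_eq_iff)
next
  case (Suc d)
  then have d: "d < p" by simp
  note \<phi> = Suc.prems(2)
  define \<psi> where "\<psi> w = (\<integral>\<^sup>+v. indicator {0..1} v * \<phi> (w(d := v)) \<partial>lborel)" for w :: "nat \<Rightarrow> real"
  have upd: "(\<lambda>(w, v). \<phi> (w(d := v))) \<in> borel_measurable (lborel_pow d \<Otimes>\<^sub>M lborel)"
    using measurable_compose[OF measurable_fun_upd_lborel_pow \<phi>] by (simp only: split_beta')
  have \<psi>_meas: "\<psi> \<in> borel_measurable (lborel_pow d)"
  proof -
    have "(\<lambda>(w, v). indicator {0..1} v * \<phi> (w(d := v))) \<in> borel_measurable (lborel_pow d \<Otimes>\<^sub>M lborel)"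
      using upd unfolding split_beta' by measurable
    then show ?thesis unfolding \<psi>_def[abs_def] by (rule lborel.borel_measurable_nn_integral)
  qed
  have inner: "(\<integral>\<^sup>+t. ennreal (gc d y t) * \<phi> ((rosenblatt d gc y)(d := cond_cdf gc d y t)) \<partial>lborel)
      = \<psi> (rosenblatt d gc y)"
    if y: "y \<in> space (lborel_pow d)" and pos: "0 < prefix_density gc d y" for y
  proof -
    have Ry: "rosenblatt d gc y \<in> space (lborel_pow d)"
      by (auto simp: space_lborel_pow rosenblatt_def)
    have "(\<lambda>v. \<phi> ((rosenblatt d gc y)(d := v))) \<in> borel_measurable borel"
      using measurable_compose[OF measurable_Pair1'[OF Ry] upd] by simp
    then show ?thesis
      unfolding \<psi>_def cond_cdf_def
      by (rule nn_integral_probability_transform[OF gc_pdf[OF d y pos]])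
  qed
  have cube: "indicator (unit_cube (Suc d)) (w(d := v))
      = (indicator (unit_cube d) w * indicator {0..1} v :: ennreal)"
    if "w \<in> space (lborel_pow d)" for w v
    using that unfolding unit_cube_def space_lborel_pow
    by (auto simp: indicator_def PiE_iff less_Suc_eq extensional_def split: if_splits)
  have "(\<integral>\<^sup>+x. ennreal (prefix_density gc (Suc d) x) * \<phi> (rosenblatt (Suc d) gc x) \<partial>lborel_pow (Suc d))
      = (\<integral>\<^sup>+y. ennreal (prefix_density gc d y) *
          (\<integral>\<^sup>+t. ennreal (gc d y t) * \<phi> (rosenblatt (Suc d) gc (y(d := t))) \<partial>lborel) \<partial>lborel_pow d)"
    using Suc.prems(1)
    by (intro nn_integral_prefix_density_Suc d measurable_compose[OF rosenblatt_measurable \<phi>])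
  also have "\<dots> = (\<integral>\<^sup>+y. ennreal (prefix_density gc d y) * \<psi> (rosenblatt d gc y) \<partial>lborel_pow d)"
  proof (rule nn_integral_cong)
    fix y assume y: "y \<in> space (lborel_pow d)"
    \<comment> \<open>\<open>inner\<close> is available only for prefixes of positive density; the
      others contribute 0 to both integrals.\<close>
    have "prefix_density gc d y = 0 \<or> 0 < prefix_density gc d y"
      using prefix_density_nonneg[of d y] d by auto
    then show "ennreal (prefix_density gc d y) *
          (\<integral>\<^sup>+t. ennreal (gc d y t) * \<phi> (rosenblatt (Suc d) gc (y(d := t))) \<partial>lborel)
        = ennreal (prefix_density gc d y) * \<psi> (rosenblatt d gc y)"
      unfolding rosenblatt_Suc[OF y] using inner[OF y] by auto
  qed
  also have "\<dots> = (\<integral>\<^sup>+w. indicator (unit_cube d) w * \<psi> w \<partial>lborel_pow d)"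
    using d \<psi>_meas by (intro Suc.IH) auto
  also have "\<dots> = (\<integral>\<^sup>+w. \<integral>\<^sup>+v. indicator (unit_cube (Suc d)) (w(d := v)) * \<phi> (w(d := v)) \<partial>lborel
                      \<partial>lborel_pow d)"
  proof (rule nn_integral_cong)
    fix w assume w: "w \<in> space (lborel_pow d)"
    have [measurable]: "(\<lambda>v. \<phi> (w(d := v))) \<in> borel_measurable borel"
      using measurable_compose[OF measurable_Pair1'[OF w] upd] by simp
    then show "indicator (unit_cube d) w * \<psi> w
        = (\<integral>\<^sup>+v. indicator (unit_cube (Suc d)) (w(d := v)) * \<phi> (w(d := v)) \<partial>lborel)"
      unfolding \<psi>_def cube[OF w] mult.assoc by (intro nn_integral_cmult[symmetric]) measurable
  qed
  also have "\<dots> = (\<integral>\<^sup>+u. indicator (unit_cube (Suc d)) u * \<phi> u \<partial>lborel_pow (Suc d))"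
    by (intro nn_integral_lborel_pow_Suc[symmetric] borel_measurable_times_ennreal
          borel_measurable_indicator unit_cube_measurable \<phi>)
  finally show ?case .
qed

end

section \<open>Almost sure inversion and the equality of the two densities\<close>

definition uniform_cube :: "nat \<Rightarrow> (nat \<Rightarrow> real) measure" where
  "uniform_cube d = density (lborel_pow d) (\<lambda>u. ennreal (indicator (unit_cube d) u))"

context cond_density_family
begin

text \<open>
  Implies that \<open>x d\<close> is the leftmost point at which its conditional distribution function attains its
  value there: otherwise that function would be constant between some rational number and \<open>x d\<close>.
  With countably many conditions, almost every \<open>x\<close> qualifies.
\<close>

definition leftmost :: "nat \<Rightarrow> (nat \<Rightarrow> real) \<Rightarrow> bool" where
  "leftmost d x \<longleftrightarrow> (\<forall>q::rat. cond_cdf gc d (restrict x {..<d}) (x d)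
                            \<noteq> cond_cdf gc d (restrict x {..<d}) (of_rat q))"

lemma leftmost_measurable:
  assumes "d \<le> p"
  shows "Measurable.pred (lborel_pow d) (\<lambda>x. \<forall>e<d. leftmost e x)"
proof -
  have "Measurable.pred (lborel_pow d) (\<lambda>x. leftmost e x)" if "e < d" for e
    unfolding leftmost_def
  proof (intro pred_intros_countable pred_intros_logic)
    fix q :: rat
    have
      "(\<lambda>x. cond_cdf gc e (restrict x {..<e}) (x e)) \<in> borel_measurable (lborel_pow d)"
      "(\<lambda>x. cond_cdf gc e (restrict x {..<e}) (of_rat q)) \<in> borel_measurable (lborel_pow d)"
      using that assms
      by (auto intro!: cond_cdf_component_measurable measurable_component_lborel_pow)
    then show "Measurable.pred (lborel_pow d) (\<lambda>x. cond_cdf gc e (restrict x {..<e}) (x e)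
                            = cond_cdf gc e (restrict x {..<e}) (of_rat q))"
      unfolding pred_def by (rule borel_measurable_eq)
  qed
  then have "Measurable.pred (lborel_pow d) (\<lambda>x. \<forall>e\<in>{..<d}. leftmost e x)"
    unfolding pred_def by (intro sets.sets_Collect_finite_All) simp_all
  then show ?thesis by (simp only: Ball_def lessThan_iff)
qed

lemma indicator_not_leftmost_measurable:
  assumes "d \<le> p"
  shows "(indicator {x. \<not> (\<forall>e<d. leftmost e x)} :: _ \<Rightarrow> ennreal) \<in> borel_measurable (lborel_pow d)"
proof -
  have "{x. \<not> (\<forall>e<d. leftmost e x)} \<inter> space (lborel_pow d)
      = space (lborel_pow d) - {x \<in> space (lborel_pow d). \<forall>e<d. leftmost e x}"
    by auto
  also have "\<dots> \<in> sets (lborel_pow d)"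
    using leftmost_measurable[OF assms] unfolding pred_def by (intro sets.compl_sets)
  finally show ?thesis by (simp only: borel_measurable_indicator_iff)
qed

text \<open>Induction on the dimension. A prefix that already fails keeps its mass, since the next
  density integrates to 1. For a good prefix, failure puts the next transformed coordinate into the
  countable set of values at rationals, which a uniform variable avoids almost surely.\<close>

lemma nn_integral_not_leftmost:
  assumes "d \<le> p"
  shows "(\<integral>\<^sup>+x. ennreal (prefix_density gc d x) * indicator {x. \<not> (\<forall>e<d. leftmost e x)} x
            \<partial>lborel_pow d) = 0"
  using assms
proof (induction d)
  case (Suc d)
  then have d: "d < p" by simp
  let ?B = "\<lambda>d. {x. \<not> (\<forall>e<d. leftmost e x)}"
  let ?C = "\<lambda>y. range (\<lambda>q::rat. cond_cdf gc d y (of_rat q))"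
  have inner: "(\<integral>\<^sup>+t. ennreal (gc d y t) * indicator (?B (Suc d)) (y(d := t)) \<partial>lborel)
      = indicator (?B d) y" if y: "y \<in> space (lborel_pow d)" and pos: "0 < prefix_density gc d y" for y
  proof (cases "y \<in> ?B d")
    case True
    have "y(d := t) \<in> ?B (Suc d)" for t
    proof -
      from True obtain e where "e < d" "\<not> leftmost e y" by auto
      then have "\<not> leftmost e (y(d := t))"
        by (simp add: leftmost_def restrict_fun_upd_below)
      then show ?thesis using \<open>e < d\<close> by (auto intro: less_SucI)
    qed
    then show ?thesis
      using True gc_pdf[OF d y pos] by (simp add: is_pdf_def)
  next
    case False
    have ext: "y \<in> extensional {..<d}" using y by (simp add: space_lborel_pow)
    have transform: "(\<integral>\<^sup>+t. ennreal (gc d y t) * \<phi> (cond_cdf gc d y t) \<partial>lborel)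
        = (\<integral>\<^sup>+v. indicator {0..1} v * \<phi> v \<partial>lborel)" if "\<phi> \<in> borel_measurable borel" for \<phi>
      unfolding cond_cdf_def
      by (rule nn_integral_probability_transform[OF gc_pdf[OF d y pos] that])
    have C: "?C y \<in> null_sets lborel"
      by (intro countable_imp_null_set_lborel) auto
    have "indicator (?B (Suc d)) (y(d := t)) \<le> (indicator (?C y) (cond_cdf gc d y t) :: ennreal)" for t
    proof (cases "y(d := t) \<in> ?B (Suc d)")
      case True
      then obtain e where e: "e < Suc d" "\<not> leftmost e (y(d := t))" by auto
      have "e = d"
      proof (rule ccontr)
        assume "e \<noteq> d"
        then have "e < d" using e by simp
        then have "\<not> leftmost e y"
          using e by (simp add: leftmost_def restrict_fun_upd_below)
        then show False using False \<open>e < d\<close> by auto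
      qed
      then have "cond_cdf gc d y t \<in> ?C y"
        using e ext by (auto simp: leftmost_def restrict_fun_upd_below extensional_restrict)
      then show ?thesis by (simp add: indicator_def)
    qed simp
    then have "(\<integral>\<^sup>+t. ennreal (gc d y t) * indicator (?B (Suc d)) (y(d := t)) \<partial>lborel)
        \<le> (\<integral>\<^sup>+t. ennreal (gc d y t) * indicator (?C y) (cond_cdf gc d y t) \<partial>lborel)"
      by (intro nn_integral_mono mult_left_mono) auto
    also have "\<dots> = (\<integral>\<^sup>+v. indicator {0..1} v * indicator (?C y) v \<partial>lborel)"
      using C by (intro transform borel_measurable_indicator) (simp add: null_sets_def)
    also have "\<dots> = 0"
      using C by (intro nn_integral_zero'[OF AE_mp[OF AE_not_in]]) (auto simp: indicator_def)
    finally show ?thesis using False by simp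
  qed
  have "(\<integral>\<^sup>+x. ennreal (prefix_density gc (Suc d) x) * indicator (?B (Suc d)) x \<partial>lborel_pow (Suc d))
      = (\<integral>\<^sup>+y. ennreal (prefix_density gc d y) *
          (\<integral>\<^sup>+t. ennreal (gc d y t) * indicator (?B (Suc d)) (y(d := t)) \<partial>lborel) \<partial>lborel_pow d)"
    by (rule nn_integral_prefix_density_Suc[OF d indicator_not_leftmost_measurable[OF Suc.prems]])
  also have "\<dots> = (\<integral>\<^sup>+y. ennreal (prefix_density gc d y) * indicator (?B d) y \<partial>lborel_pow d)"
  proof (rule nn_integral_cong)
    fix y assume y: "y \<in> space (lborel_pow d)"
    have "prefix_density gc d y = 0 \<or> 0 < prefix_density gc d y"
      using prefix_density_nonneg[of d y] d by auto
    then show "ennreal (prefix_density gc d y) *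
          (\<integral>\<^sup>+t. ennreal (gc d y t) * indicator (?B (Suc d)) (y(d := t)) \<partial>lborel)
        = ennreal (prefix_density gc d y) * indicator (?B d) y"
      using inner[OF y] by auto
  qed
  also have "\<dots> = 0" using Suc by simp
  finally show ?case .
qed simp

lemma AE_leftmost:
  "AE x in lborel_pow p. 0 < prefix_density gc p x \<longrightarrow> (\<forall>e<p. leftmost e x)"
proof -
  let ?h = "\<lambda>x. ennreal (prefix_density gc p x) * indicator {x. \<not> (\<forall>e<p. leftmost e x)} x"
  have "?h \<in> borel_measurable (lborel_pow p)"
    by (intro borel_measurable_times_ennreal indicator_not_leftmost_measurable order_refl
          measurable_compose[OF prefix_density_measurable measurable_ennreal])
  then have "AE x in lborel_pow p. ?h x = 0"
    using nn_integral_not_leftmost[OF order_refl] by (rule nn_integral_0_iff_AE[THEN iffD1])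
  then show ?thesis by (elim eventually_mono) (auto simp: indicator_def split: if_splits)
qed

text \<open>The recursion recovers longer and longer prefixes of \<open>x\<close>: the part already
  recovered is the condition for the next quantile, and \<open>leftmost\<close> makes that quantile
  return the original coordinate.\<close>

lemma inv_rosenblatt_rosenblatt:
  assumes x: "x \<in> space (lborel_pow p)" and pos: "0 < prefix_density gc p x"
    and lm: "\<forall>e<p. leftmost e x"
  shows "inv_rosenblatt p gc (rosenblatt p gc x) = x"
proof -
  have "inv_rosenblatt d gc (rosenblatt p gc x) = restrict x {..<d}" if "d \<le> p" for d
    using that
  proof (induction d)
    case (Suc d)
    let ?y = "restrict x {..<d}"
    have "0 < prefix_density gc d ?y"
      using prefix_density_pos[of d p x] pos Suc.prems by (simp add: prefix_density_restrict)
    then have pdf: "is_pdf lborel (gc d ?y)"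
      using Suc.prems by (intro gc_pdf) (auto simp: space_lborel_pow)
    have "cond_quantile gc d ?y (cond_cdf gc d ?y (x d)) = x d"
      unfolding cond_quantile_def cond_cdf_def
      using lm Suc.prems
      by (intro quantile_cdf[OF pdf]) (auto simp: leftmost_def cond_cdf_def)
    moreover have "rosenblatt p gc x d = cond_cdf gc d ?y (x d)"
      using Suc.prems by (simp add: rosenblatt_def)
    moreover have "inv_rosenblatt d gc (rosenblatt p gc x) = ?y"
      using Suc.prems by (intro Suc.IH) simp
    ultimately have "inv_rosenblatt (Suc d) gc (rosenblatt p gc x) = ?y(d := x d)"
      by (simp add: Let_def)
    then show ?case by (auto simp: fun_eq_iff less_Suc_eq)
  qed auto
  from this[of p] show ?thesis using x by (simp add: space_lborel_pow extensional_restrict)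
qed

lemma distr_rosenblatt:
  "distr (density (lborel_pow p) (\<lambda>x. ennreal (prefix_density gc p x))) (lborel_pow p) (rosenblatt p gc)
     = uniform_cube p"
proof (rule measure_eqI)
  have [measurable]: "prefix_density gc p \<in> borel_measurable (lborel_pow p)"
    by (intro prefix_density_measurable) simp
  have R: "rosenblatt p gc \<in> measurable (lborel_pow p) (lborel_pow p)"
    by (intro rosenblatt_measurable) simp
  let ?G = "density (lborel_pow p) (\<lambda>x. ennreal (prefix_density gc p x))"
  fix A assume "A \<in> sets (distr ?G (lborel_pow p) (rosenblatt p gc))"
  then have A: "A \<in> sets (lborel_pow p)" by simp
  have "emeasure (distr ?G (lborel_pow p) (rosenblatt p gc)) A
      = (\<integral>\<^sup>+x. indicator A (rosenblatt p gc x) \<partial>?G)"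
    using A R by (simp flip: nn_integral_indicator add: nn_integral_distr)
  also have "\<dots> = (\<integral>\<^sup>+x. ennreal (prefix_density gc p x) * indicator A (rosenblatt p gc x) \<partial>lborel_pow p)"
    using measurable_compose[OF R borel_measurable_indicator[OF A]]
    by (intro nn_integral_density) auto
  also have "\<dots> = (\<integral>\<^sup>+u. indicator (unit_cube p) u * indicator A u \<partial>lborel_pow p)"
    using A by (intro nn_integral_rosenblatt) auto
  also have "\<dots> = emeasure (uniform_cube p) A"
    unfolding uniform_cube_def using A
    by (subst emeasure_density) (auto simp: ennreal_indicator)
  finally show "emeasure (distr ?G (lborel_pow p) (rosenblatt p gc)) A = emeasure (uniform_cube p) A" .
qed (simp add: uniform_cube_def)

text \<open>The null hypothesis holds almost everywhere on the cube. Since the transformation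
  carries the law with density \<open>g\<close> to the uniform law, it pulls back to almost every
  \<open>x\<close> with \<open>g x > 0\<close>; there inversion returns \<open>x\<close> and gives
  \<open>f x / g x = 1\<close>. Where \<open>g\<close> vanishes, so does \<open>f\<close>.\<close>

lemma AE_eq_of_null_hypothesis:
  assumes g: "\<And>x. x \<in> space (lborel_pow p) \<Longrightarrow> g x = prefix_density gc p x"
    and f0: "\<And>x. x \<in> space (lborel_pow p) \<Longrightarrow> g x = 0 \<Longrightarrow> f x = 0"
    and null: "null_hypothesis p f g gc"
  shows "AE x in lborel_pow p. f x = prefix_density gc p x"
proof -
  have [measurable]: "prefix_density gc p \<in> borel_measurable (lborel_pow p)"
    by (intro prefix_density_measurable) simp
  have R: "rosenblatt p gc \<in> measurable (lborel_pow p) (lborel_pow p)"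
    by (intro rosenblatt_measurable) simp
  then have R': "rosenblatt p gc
      \<in> measurable (density (lborel_pow p) (\<lambda>x. ennreal (prefix_density gc p x))) (lborel_pow p)"
    by simp
  have "AE u in uniform_cube p. likelihood_ratio p f g gc u = 1"
  proof -
    have "AE u in lborel_pow p. 0 < ennreal (indicator (unit_cube p) u) \<longrightarrow> likelihood_ratio p f g gc u = 1"
      using null unfolding null_hypothesis_def
      by eventually_elim (simp add: indicator_def split: if_splits)
    then show ?thesis
      unfolding uniform_cube_def by (subst AE_density) simp_all
  qed
  then have "AE x in density (lborel_pow p) (\<lambda>x. ennreal (prefix_density gc p x)).
      likelihood_ratio p f g gc (rosenblatt p gc x) = 1"
    unfolding distr_rosenblatt[symmetric] by (intro AE_distrD[OF R'])
  then have "AE x in lborel_pow p. 0 < prefix_density gc p x \<longrightarrow>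
      likelihood_ratio p f g gc (rosenblatt p gc x) = 1"
    by (subst (asm) AE_density) simp_all
  then show ?thesis
    using AE_leftmost AE_space
  proof eventually_elim
    case (elim x)
    show ?case
    proof (cases "0 < prefix_density gc p x")
      case True
      then have "f x / g x = 1"
        using elim inv_rosenblatt_rosenblatt[of x] by (simp add: likelihood_ratio_def)
      then show ?thesis using g elim True by simp
    next
      case False
      then have "prefix_density gc p x = 0" using prefix_density_nonneg[of p x] by simp
      then show ?thesis using g f0 elim by simp
    qed
  qed
qed

end

section \<open>Selection among estimated coefficients\<close>

lemma tensor_legendre_measurable: "tensor_legendre p k \<in> borel_measurable (lborel_pow p)"
proof -
  have "(\<lambda>u. legendre (k d) (u d)) \<in> borel_measurable (lborel_pow p)" if "d < p" for d
  proof -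
    have "legendre (k d) \<in> borel_measurable borel"
      unfolding legendre_def by (intro borel_measurable_continuous_onI continuous_intros)
    from measurable_compose[OF measurable_component_lborel_pow[OF that] this] show ?thesis .
  qed
  then show ?thesis unfolding tensor_legendre_def[abs_def] by (intro borel_measurable_prod) auto
qed

text \<open>The indicator of the cube and both basis functions factorize, so the integral is a
  product of one-dimensional ones. Extensionality ensures that distinct tuples differ at some
  \<open>d < p\<close>, which makes one factor 0.\<close>

lemma tensor_legendre_orthonormal:
  assumes "k \<in> extensional {..<p}" "l \<in> extensional {..<p}"
  shows "integrable (uniform_cube p) (\<lambda>u. tensor_legendre p k u * tensor_legendre p l u)"
    and "(\<integral>u. tensor_legendre p k u * tensor_legendre p l u \<partial>uniform_cube p) = (if k = l then 1 else 0)"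
proof -
  interpret product_sigma_finite "\<lambda>_. lborel :: real measure" by unfold_locales
  let ?T = "\<lambda>u. tensor_legendre p k u * tensor_legendre p l u"
  let ?t = "\<lambda>d v. indicator {0..1} v *\<^sub>R (legendre (k d) v * legendre (l d) v)"
  have T: "?T \<in> borel_measurable (lborel_pow p)"
    by (intro borel_measurable_times tensor_legendre_measurable)
  have eq: "indicator (unit_cube p) u *\<^sub>R ?T u = (\<Prod>d<p. ?t d (u d))"
    if "u \<in> space (lborel_pow p)" for u
  proof -
    have "indicator (unit_cube p) u = (\<Prod>d<p. indicator {0..1} (u d) :: real)"
      using that unfolding space_lborel_pow unit_cube_def
      by (auto simp: indicator_def PiE_iff prod_zero_iff)
    then show ?thesis by (simp add: tensor_legendre_def prod.distrib)
  qed
  have t_int: "integrable lborel (?t d)" for d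
    using legendre_orthonormal(1) by (simp add: set_integrable_def)
  have "integrable (lborel_pow p) (\<lambda>u. \<Prod>d<p. ?t d (u d))"
    unfolding lborel_pow_def by (intro product_integrable_prod t_int) simp
  then have "integrable (lborel_pow p) (\<lambda>u. indicator (unit_cube p) u *\<^sub>R ?T u)"
    by (subst Bochner_Integration.integrable_cong[OF refl eq])
  then show "integrable (uniform_cube p) ?T"
    unfolding uniform_cube_def by (subst integrable_density) (use T in auto)
  have "(\<integral>u. ?T u \<partial>uniform_cube p) = (\<integral>u. indicator (unit_cube p) u *\<^sub>R ?T u \<partial>lborel_pow p)"
    unfolding uniform_cube_def by (subst integral_density) (use T in auto)
  also have "\<dots> = (\<integral>u. (\<Prod>d<p. ?t d (u d)) \<partial>lborel_pow p)"
    by (rule Bochner_Integration.integral_cong[OF refl eq])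
  also have "\<dots> = (\<Prod>d<p. integral\<^sup>L lborel (?t d))"
    unfolding lborel_pow_def by (intro product_integral_prod t_int) simp
  also have "\<dots> = (\<Prod>d<p. if k d = l d then 1 else 0)"
    using legendre_orthonormal(2) by (simp add: set_lebesgue_integral_def)
  also have "\<dots> = (if k = l then 1 else 0)"
  proof (cases "k = l")
    case False
    then obtain d where "d < p" "k d \<noteq> l d"
      using extensionalityI[OF assms] by blast
    then show ?thesis using False by (auto simp: prod_zero_iff)
  qed simp
  finally show "(\<integral>u. ?T u \<partial>uniform_cube p) = (if k = l then 1 else 0)" .
qed

text \<open>The terms are squares, so extending the sum to all coefficients can only increase it,
  and the full sum does not depend on the enumeration \<open>s\<close>.\<close>

lemma deviance_le:
  assumes order: "magnitude_order p m \<theta> s" and K: "K \<le> num_coeffs p m"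
  shows "deviance n \<theta> s K \<le> real n * (\<Sum>k\<in>index_set p m. (\<theta> k)\<^sup>2)"
proof -
  have "(\<Sum>i=1..K. (\<theta> (s i))\<^sup>2) \<le> (\<Sum>i=1..num_coeffs p m. (\<theta> (s i))\<^sup>2)"
    using K by (intro sum_mono2) auto
  also have "\<dots> = (\<Sum>k\<in>index_set p m. (\<theta> k)\<^sup>2)"
    using order unfolding magnitude_order_def by (intro sum.reindex_bij_betw) simp
  finally show ?thesis unfolding deviance_def by (intro mult_left_mono) auto
qed

section \<open>Basis values at uniform points as standardized vectors\<close>

lemma finite_index_set: "finite (index_set p m)"
  unfolding index_set_def by (intro finite_Diff finite_PiE) auto

lemma index_set_extensional: "k \<in> index_set p m \<Longrightarrow> k \<in> extensional {..<p}"
  by (auto simp: index_set_def PiE_def)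

lemma tensor_legendre_zero: "tensor_legendre p (\<lambda>d\<in>{..<p}. 0) u = 1"
  by (simp add: tensor_legendre_def legendre_0)

text \<open>Orthonormality in \<open>L^2\<close> of the cube becomes identity covariance. The zero
  tuple, whose basis function is constant 1, is excluded from \<open>index_set\<close>, so
  orthogonality to it gives mean 0.\<close>

lemma (in prob_space) standardized_iid_tensor_legendre:
  fixes U :: "nat \<Rightarrow> 'a \<Rightarrow> nat \<Rightarrow> real" and e :: "nat \<Rightarrow> nat \<Rightarrow> nat"
  assumes indep: "indep_vars (\<lambda>_. lborel_pow p) U UNIV"
    and unif: "\<And>i. distr M (lborel_pow p) (U i) = uniform_cube p"
    and e: "bij_betw e {..<r} (index_set p m)"
  shows "standardized_iid M r (\<lambda>i \<omega>. \<lambda>j\<in>{..<r}. tensor_legendre p (e j) (U i \<omega>))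
           (distr (uniform_cube p) (\<Pi>\<^sub>M j\<in>{..<r}. borel) (\<lambda>u. \<lambda>j\<in>{..<r}. tensor_legendre p (e j) u))"
proof unfold_locales
  have U: "U i \<in> measurable M (lborel_pow p)" for i
    using indep by (auto simp: indep_vars_def)
  have Y: "(\<lambda>u. \<lambda>j\<in>{..<r}. tensor_legendre p (e j) u) \<in> measurable (lborel_pow p) (\<Pi>\<^sub>M j\<in>{..<r}. borel)"
    by (intro measurable_restrict tensor_legendre_measurable)
  have e_ext: "e j \<in> extensional {..<p}" if "j < r" for j
    using bij_betwE[OF e] that by (intro index_set_extensional) auto
  have e_nz: "e j \<noteq> (\<lambda>d\<in>{..<p}. 0)" if "j < r" for j
    using bij_betwE[OF e] that by (auto simp: index_set_def)
  have e_eq: "e j = e k \<longleftrightarrow> j = k" if "j < r" "k < r" for j k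
    using bij_betw_imp_inj_on[OF e] that by (auto simp: inj_on_eq_iff)
  let ?T = "\<lambda>k l u. tensor_legendre p k u * tensor_legendre p l u"
  have T_meas: "?T k l \<in> borel_measurable (lborel_pow p)" for k l
    by (intro borel_measurable_times tensor_legendre_measurable)
  have T_int: "integrable M (\<lambda>\<omega>. ?T k l (U i \<omega>))"
    and T_val: "expectation (\<lambda>\<omega>. ?T k l (U i \<omega>)) = (if k = l then 1 else 0)"
    if "k \<in> extensional {..<p}" "l \<in> extensional {..<p}" for k l i
    using tensor_legendre_orthonormal[OF that]
    unfolding unif[of i, symmetric] integrable_distr_eq[OF U T_meas] integral_distr[OF U T_meas] .
  show "indep_vars (\<lambda>_. \<Pi>\<^sub>M j\<in>{..<r}. borel)
      (\<lambda>i \<omega>. \<lambda>j\<in>{..<r}. tensor_legendre p (e j) (U i \<omega>)) UNIV"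
    by (rule indep_vars_compose2[OF indep Y])
  show "distr M (\<Pi>\<^sub>M j\<in>{..<r}. borel) (\<lambda>\<omega>. \<lambda>j\<in>{..<r}. tensor_legendre p (e j) (U i \<omega>))
      = distr (uniform_cube p) (\<Pi>\<^sub>M j\<in>{..<r}. borel) (\<lambda>u. \<lambda>j\<in>{..<r}. tensor_legendre p (e j) u)" for i
    unfolding unif[of i, symmetric] by (subst distr_distr[OF Y U]) (simp add: comp_def)
  fix i j k assume j: "j < r"
  show "integrable M (\<lambda>\<omega>. ((\<lambda>j\<in>{..<r}. tensor_legendre p (e j) (U i \<omega>)) j)\<^sup>2)"
    using j T_int[OF e_ext e_ext, of j j i] by (simp add: power2_eq_square)
  show "expectation (\<lambda>\<omega>. (\<lambda>j\<in>{..<r}. tensor_legendre p (e j) (U i \<omega>)) j) = 0"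
    using j T_val[OF e_ext[OF j], of "\<lambda>d\<in>{..<p}. 0" i] e_nz[OF j]
    by (simp add: tensor_legendre_zero)
  assume k: "k < r"
  show "expectation (\<lambda>\<omega>. (\<lambda>j\<in>{..<r}. tensor_legendre p (e j) (U i \<omega>)) j *
                              (\<lambda>j\<in>{..<r}. tensor_legendre p (e j) (U i \<omega>)) k) = (if j = k then 1 else 0)"
    using j k T_val[OF e_ext[OF j] e_ext[OF k], of i] e_eq[OF j k] by simp
qed

section \<open>The limiting bound for the selected deviance\<close>

theorem corollary4p3:
  fixes p :: nat
    and f g :: "(nat \<Rightarrow> real) \<Rightarrow> real"
    and gc :: cond_densities
    and m :: "nat \<Rightarrow> nat"
    and P :: "'a measure"
    and X :: "nat \<Rightarrow> 'a \<Rightarrow> nat \<Rightarrow> real"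
    and crit :: selection_criterion
    and s :: "nat \<Rightarrow> 'a \<Rightarrow> nat \<Rightarrow> nat \<Rightarrow> nat"
    and K :: "nat \<Rightarrow> 'a \<Rightarrow> nat"
    and t :: real
  assumes "is_pdf (lborel_pow p) f" and "is_pdf (lborel_pow p) g"
    and "\<forall>x\<in>space (lborel_pow p). g x = 0 \<longrightarrow> f x = 0"
    and "is_cond_densities p gc"
    and "\<forall>x\<in>space (lborel_pow p). g x = (\<Prod>d<p. gc d (restrict x {..<d}) (x d))"
    and "in_L2_cube p (likelihood_ratio p f g gc)"
    and "\<exists>d<p. m d \<noteq> 0"
    and "prob_space P"
    and "\<forall>i. distributed P (lborel_pow p) (X i) (\<lambda>x. ennreal (f x))"
    and "prob_space.indep_vars P (\<lambda>_. lborel_pow p) X UNIV"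
    and "crit = BIC \<or> crit = AIC"
    and "\<forall>n\<ge>1. \<forall>\<omega>\<in>space P.
           magnitude_order p m (theta_hat p gc (\<lambda>i. X i \<omega>) n) (s n \<omega>)"
    and "\<forall>n\<ge>1. K n \<in> measurable P (count_space UNIV)"
    and "\<forall>n\<ge>1. \<forall>\<omega>\<in>space P.
           is_arg_max (crit n (theta_hat p gc (\<lambda>i. X i \<omega>) n) (s n \<omega>))
             (\<lambda>k. k \<in> {1..num_coeffs p m}) (K n \<omega>)"
    and "null_hypothesis p f g gc"
    and "0 \<le> t"
  shows "limsup (\<lambda>n. ereal (measure P {\<omega> \<in> space P.
           deviance n (theta_hat p gc (\<lambda>i. X i \<omega>) n) (s n \<omega>) (K n \<omega>) > t}))
         \<le> ereal (adjusted_p_value p m t)"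
proof -
  interpret P: prob_space P by fact
  interpret cond_density_family p gc by unfold_locales fact
  define M where "M = num_coeffs p m"
  define U where "U i \<omega> = rosenblatt p gc (X i \<omega>)" for i \<omega>
  have K: "1 \<le> K n \<omega>" "K n \<omega> \<le> M" if "1 \<le> n" "\<omega> \<in> space P" for n \<omega>
    using assms(14) that by (auto simp: is_arg_max_def M_def)
  \<comment> \<open>The selected number lies between 1 and \<open>M\<close>, so a single sample
    point shows that \<open>M\<close> is positive, as the tail limit requires.\<close>
  obtain \<omega>0 where "\<omega>0 \<in> space P" using P.not_empty by blast
  then have "0 < M" using K[of 1 \<omega>0] by simp
  \<comment> \<open>Unlike the random order \<open>s n \<omega>\<close>, this enumeration is the
    same for all data, so the limit theorem can use it for its coordinates.\<close>
  obtain e where e: "bij_betw e {..<M} (index_set p m)"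
    using ex_bij_betw_nat_finite[OF finite_index_set, of p m]
    by (auto simp: M_def num_coeffs_def lessThan_atLeast0)
  have R: "rosenblatt p gc \<in> measurable (lborel_pow p) (lborel_pow p)"
    by (intro rosenblatt_measurable) simp
  have U_indep: "P.indep_vars (\<lambda>_. lborel_pow p) U UNIV"
    unfolding U_def[abs_def] by (rule P.indep_vars_compose2[OF assms(10) R])
  have "AE x in lborel_pow p. f x = prefix_density gc p x"
    using assms(3,5,15) by (intro AE_eq_of_null_hypothesis[of g f]) (auto simp: prefix_density_def)
  then have f_dens: "density (lborel_pow p) (\<lambda>x. ennreal (f x))
      = density (lborel_pow p) (\<lambda>x. ennreal (prefix_density gc p x))"
    using assms(1) prefix_density_measurable[of p]
    by (intro density_cong) (auto simp: is_pdf_def elim!: eventually_mono)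
  have U_unif: "distr P (lborel_pow p) (U i) = uniform_cube p" for i
  proof -
    have X: "distr P (lborel_pow p) (X i) = density (lborel_pow p) (\<lambda>x. ennreal (f x))"
      and X_meas: "X i \<in> measurable P (lborel_pow p)"
      using assms(9) by (auto simp: distributed_def)
    have "distr P (lborel_pow p) (U i) = distr (distr P (lborel_pow p) (X i)) (lborel_pow p) (rosenblatt p gc)"
      unfolding U_def[abs_def] by (subst distr_distr[OF R X_meas]) (simp add: comp_def)
    then show ?thesis unfolding X f_dens distr_rosenblatt .
  qed
  interpret standardized_iid P M "\<lambda>i \<omega>. \<lambda>j\<in>{..<M}. tensor_legendre p (e j) (U i \<omega>)"
    "distr (uniform_cube p) (\<Pi>\<^sub>M j\<in>{..<M}. borel) (\<lambda>u. \<lambda>j\<in>{..<M}. tensor_legendre p (e j) u)"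
    by (rule P.standardized_iid_tensor_legendre[OF U_indep U_unif e])
  have dev: "deviance n (theta_hat p gc (\<lambda>i. X i \<omega>) n) (s n \<omega>) (K n \<omega>) \<le> S n \<omega>"
    if n: "1 \<le> n" and \<omega>: "\<omega> \<in> space P" for n \<omega>
  proof -
    let ?\<theta> = "theta_hat p gc (\<lambda>i. X i \<omega>) n"
    have "deviance n ?\<theta> (s n \<omega>) (K n \<omega>) \<le> real n * (\<Sum>k\<in>index_set p m. (?\<theta> k)\<^sup>2)"
      using assms(12) K[OF n \<omega>] n \<omega> by (intro deviance_le) (auto simp: M_def)
    also have "\<dots> = (\<Sum>j<M. real n * (?\<theta> (e j))\<^sup>2)"
      unfolding sum.reindex_bij_betw[OF e, symmetric] sum_distrib_left ..
    \<comment> \<open>Each coordinate of \<open>Z\<close> is \<open>sqrt (real n)\<close> times an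
      estimate, so its square is \<open>real n\<close> times the squared estimate; this uses
      \<open>n \<ge> 1\<close>.\<close>
    also have "\<dots> = S n \<omega>"
      unfolding S_def Z_def theta_hat_def using n
      by (intro sum.cong) (auto simp: U_def power_divide power2_eq_square)
    finally show ?thesis .
  qed
  have "limsup (\<lambda>n. ereal (measure P {\<omega> \<in> space P.
           deviance n (theta_hat p gc (\<lambda>i. X i \<omega>) n) (s n \<omega>) (K n \<omega>) > t}))
      \<le> limsup (\<lambda>n. ereal (measure P {\<omega> \<in> space P. S n \<omega> \<ge> t}))"
  \<comment> \<open>The event \<open>deviance > t\<close> is enlarged to
    \<open>S n \<omega> \<ge> t\<close>, whose limit is the chi-square tail. Only
    \<open>n \<ge> 1\<close> is compared, the range in which the selection is specified.\<close>
  proof (rule Limsup_mono)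
    show "\<forall>\<^sub>F n in sequentially. ereal (measure P {\<omega> \<in> space P.
           deviance n (theta_hat p gc (\<lambda>i. X i \<omega>) n) (s n \<omega>) (K n \<omega>) > t})
        \<le> ereal (measure P {\<omega> \<in> space P. S n \<omega> \<ge> t})"
      using eventually_ge_at_top[of 1]
    proof eventually_elim
      case (elim n)
      have "measure P {\<omega> \<in> space P. deviance n (theta_hat p gc (\<lambda>i. X i \<omega>) n) (s n \<omega>) (K n \<omega>) > t}
          \<le> measure P {\<omega> \<in> space P. S n \<omega> \<ge> t}"
        using dev[OF elim] by (intro P.finite_measure_mono) (fastforce, measurable)
      then show ?case by simp
    qed
  qed
  also have "\<dots> = ereal (measure (chi_square M) {y. y > t})"
    using S_tail_tendsto[OF \<open>0 < M\<close>, of t] by (intro lim_imp_Limsup) simp_all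
  finally show ?thesis by (simp add: adjusted_p_value_def M_def)
qed

end
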